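(* Let $R$ be a commutative ring of characteristic $0$, let $F$ and $F'$ be formal group laws over $R$, let $\Lambda$ be a free abelian group of finite rank, and let $W$ be a finite group acting on $\Lambda$ by $\mathbb Z$-linear automorphisms. Then for every $d\ge 1$ the $W$-action on $\Lambda$ has a finite exponent from $F$ to $F'$ in degree $d$; that is, the exponent $\tau_d^{F\to F'}$ exists.
   Context: A (commutative one-dimensional) formal group law over a commutative ring $R$ is a power series $F(u,v)=u+v+\sum_{i,j\ge1}a_{ij}u^iv^j\in R[[u,v]]$ with $a_{ij}=a_{ji}$ satisfying the group law axioms (associativity); write $u+_Fv=F(u,v)$, $-_Fu$ for the formal inverse, and for $a\in\mathbb Z$ write $a\cdot_F u$ for the $|a|$-fold $F$-sum of $u$ (resp. of $-_Fu$ if $a<0$). Let $\Lambda$ be a free abelian group of finite rank. The formal group algebra $R[[\Lambda]]_F$ is the quotient of $R[[x_\Lambda]]$ (the completion of the polynomial ring $R[x_\lambda:\lambda\in\Lambda]$ along the kernel of $x_\lambda\mapsto 0$) by the closure of the ideal generated by $x_0$ and all $x_{\lambda_1+\lambda_2}-(x_{\lambda_1}+_Fx_{\lambda_2})$; the class of $x_\lambda$ is again denoted $x_\lambda$. Let $\mathcal I_F$ be the kernel of the augmentation $R[[\Lambda]]_F\to R$, $x_\lambda\mapsto0$, and $\mathcal I_F^{(d)}=\mathcal I_F^d/\mathcal I_F^{d+1}$. A finite group $W$ acting linearly on $\Lambda$ acts on $R[[\Lambda]]_F$ by $w(x_\lambda)=x_{w(\lambda)}$; $R[[\Lambda]]_F^W$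 is the ring of invariants, $\mathcal I_F^W$ is the ideal of $R[[\Lambda]]_F$ generated by $R[[\Lambda]]_F^W\cap\mathcal I_F$, and $(\mathcal I_F^W)^{(d)}=(\mathcal I_F^W\cap\mathcal I_F^d)/(\mathcal I_F^W\cap\mathcal I_F^{d+1})\subseteq\mathcal I_F^{(d)}$. For two formal group laws $F,F'$ over $R$, $\Phi_d^{F\to F'}:\mathcal I_F^{(d)}\to\mathcal I_{F'}^{(d)}$ is the $R$-module isomorphism with $\Phi_d^{F\to F'}(x_{\lambda_1}\cdots x_{\lambda_d})=x_{\lambda_1}\cdots x_{\lambda_d}$ (it is induced by the deformation map, the $R$-algebra isomorphism $\Phi^{F\to F'}:R[[\Lambda]]_F\to R[[\Lambda]]_{F'}$ which, for a fixed basis $\omega_1,\dots,\omega_n$ of $\Lambda$, sends $x_{\omega_i}\mapsto x_{\omega_i}$ and $x_\lambda$ with $\lambda=\sum a_i\omega_i$ to $(a_1\cdot_Fx_{\omega_1})+_F\cdots+_F(a_n\cdot_Fx_{\omega_n})$). The $W$-action has a finite exponent from $F$ to $F'$ in degree $d$ if there is a positive integer $N$ coprime to the characteristic of $R$ with $N\cdot(\mathcal I_{F'}^W)^{(d)}\subseteq\Phi_d^{F\to F'}\big((\mathcal I_F^W)^{(d)}\big)$; the smallest such $N$ is denoted $\tau_d^{F\to F'}$ (the $d$-th exponent from $F$ to $F'$). *)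

theory Defs
  imports "HOL-Algebra.Group" "HOL-Library.Numeral_Type"
begin

text \<open>A power series in the variables indexed by the finite type 'n is a function from
monomials (exponent vectors 'n => nat) to coefficients.\<close>

type_synonym ('a, 'n) mps = "('n \<Rightarrow> nat) \<Rightarrow> 'a"

definition mdeg :: "('n::finite \<Rightarrow> nat) \<Rightarrow> nat" where
  "mdeg m = (\<Sum>i\<in>UNIV. m i)"

definition mps_zero :: "('a::comm_ring_1, 'n) mps" where
  "mps_zero = (\<lambda>m. 0)"

definition mps_one :: "('a::comm_ring_1, 'n) mps" where
  "mps_one = (\<lambda>m. if m = (\<lambda>i. 0) then 1 else 0)"

definition mps_X :: "'n \<Rightarrow> ('a::comm_ring_1, 'n) mps" where
  "mps_X i = (\<lambda>m. if m = (\<lambda>j. if j = i then 1 else 0) then 1 else 0)"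

definition mps_mult :: "('a::comm_ring_1, 'n::finite) mps \<Rightarrow> ('a, 'n) mps \<Rightarrow> ('a, 'n) mps" where
  "mps_mult f g = (\<lambda>m. \<Sum>a\<in>{a. \<forall>i. a i \<le> m i}. f a * g (\<lambda>i. m i - a i))"

fun mps_pow :: "('a::comm_ring_1, 'n::finite) mps \<Rightarrow> nat \<Rightarrow> ('a, 'n) mps" where
  "mps_pow p 0 = mps_one"
| "mps_pow p (Suc k) = mps_mult p (mps_pow p k)"

definition mps_monom_subst :: "('n::enum \<Rightarrow> ('a::comm_ring_1, 'n) mps) \<Rightarrow> ('n \<Rightarrow> nat) \<Rightarrow> ('a, 'n) mps" where
  "mps_monom_subst \<sigma> m = foldr (\<lambda>i acc. mps_mult (mps_pow (\<sigma> i) (m i)) acc) Enum.enum mps_one"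

text \<open>Substitution p(sigma_1, ..., sigma_n) for series sigma_i without constant term
(the coefficient of k only involves monomials of degree at most deg k).\<close>
definition mps_subst :: "('a::comm_ring_1, 'n::enum) mps \<Rightarrow> ('n \<Rightarrow> ('a, 'n) mps) \<Rightarrow> ('a, 'n) mps" where
  "mps_subst p \<sigma> = (\<lambda>k. \<Sum>m\<in>{m. mdeg m \<le> mdeg k}. p m * mps_monom_subst \<sigma> m k)"

text \<open>A two-variable power series F(u,v) = sum c i j u^i v^j is given by its coefficients.
Substitution F(p,q) for series p q without constant term:\<close>
definition subst2 :: "(nat \<Rightarrow> nat \<Rightarrow> 'a::comm_ring_1) \<Rightarrow> ('a, 'n::finite) mps \<Rightarrow> ('a, 'n) mps \<Rightarrow> ('a, 'n) mps" where
  "subst2 c p q = (\<lambda>m. \<Sum>ij\<in>{(i, j). i + j \<le> mdeg m}.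
      c (fst ij) (snd ij) * mps_mult (mps_pow p (fst ij)) (mps_pow q (snd ij)) m)"

definition fgl :: "(nat \<Rightarrow> nat \<Rightarrow> 'a::comm_ring_1) \<Rightarrow> bool" where
  "fgl c \<longleftrightarrow>
     (\<forall>i. c i 0 = (if i = 1 then 1 else 0)) \<and>
     (\<forall>j. c 0 j = (if j = 1 then 1 else 0)) \<and>
     (\<forall>i j. c i j = c j i) \<and>
     subst2 c (subst2 c (mps_X (0::3)) (mps_X 1)) (mps_X 2)
       = (subst2 c (mps_X 0) (subst2 c (mps_X 1) (mps_X 2)) :: ('a, 3) mps)"

definition fgl_neg :: "(nat \<Rightarrow> nat \<Rightarrow> 'a::comm_ring_1) \<Rightarrow> ('a, 'n::finite) mps \<Rightarrow> ('a, 'n) mps" where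
  "fgl_neg c p = (THE q. q (\<lambda>i. 0) = 0 \<and> subst2 c p q = mps_zero)"

fun fgl_nmul :: "(nat \<Rightarrow> nat \<Rightarrow> 'a::comm_ring_1) \<Rightarrow> nat \<Rightarrow> ('a, 'n::finite) mps \<Rightarrow> ('a, 'n) mps" where
  "fgl_nmul c 0 p = mps_zero"
| "fgl_nmul c (Suc k) p = subst2 c (fgl_nmul c k p) p"

definition fgl_imul :: "(nat \<Rightarrow> nat \<Rightarrow> 'a::comm_ring_1) \<Rightarrow> int \<Rightarrow> ('a, 'n::finite) mps \<Rightarrow> ('a, 'n) mps" where
  "fgl_imul c a p = (if a \<ge> 0 then fgl_nmul c (nat a) p else fgl_nmul c (nat (- a)) (fgl_neg c p))"

section \<open>The formal group algebra R[[Lambda]]_F, Lambda = Z^n with basis omega_i = unit vectors\<close>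

text \<open>Via the basis, R[[Lambda]]_F is identified with R[[x_omega_1, ..., x_omega_n]], and
x_lambda = (a_1 \<cdot>_F x_1) +_F ... +_F (a_n \<cdot>_F x_n) for lambda = sum a_i omega_i.\<close>
definition xl :: "(nat \<Rightarrow> nat \<Rightarrow> 'a::comm_ring_1) \<Rightarrow> ('n::enum \<Rightarrow> int) \<Rightarrow> ('a, 'n) mps" where
  "xl c lam = foldr (\<lambda>i acc. subst2 c acc (fgl_imul c (lam i) (mps_X i))) Enum.enum mps_zero"

definition unitvec :: "'n \<Rightarrow> 'n \<Rightarrow> int" where
  "unitvec i = (\<lambda>j. if j = i then 1 else 0)"

definition lin_action :: "('g, 'b) monoid_scheme \<Rightarrow> ('g \<Rightarrow> ('n \<Rightarrow> int) \<Rightarrow> ('n \<Rightarrow> int)) \<Rightarrow> bool" where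
  "lin_action G act \<longleftrightarrow>
     (\<forall>g\<in>carrier G. \<forall>x y. act g (\<lambda>i. x i + y i) = (\<lambda>i. act g x i + act g y i)) \<and>
     act \<one>\<^bsub>G\<^esub> = id \<and>
     (\<forall>g\<in>carrier G. \<forall>h\<in>carrier G. act (g \<otimes>\<^bsub>G\<^esub> h) = act g \<circ> act h)"

text \<open>Induced action on R[[Lambda]]_F: the continuous R-algebra map with x_lambda \<mapsto> x_{g lambda},
determined by x_omega_i \<mapsto> x_{g omega_i}.\<close>
definition act_ps :: "(nat \<Rightarrow> nat \<Rightarrow> 'a::comm_ring_1) \<Rightarrow> ('g \<Rightarrow> ('n::enum \<Rightarrow> int) \<Rightarrow> ('n \<Rightarrow> int))
    \<Rightarrow> 'g \<Rightarrow> ('a, 'n) mps \<Rightarrow> ('a, 'n) mps" where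
  "act_ps c act g p = mps_subst p (\<lambda>i. xl c (act g (unitvec i)))"

definition invariants :: "(nat \<Rightarrow> nat \<Rightarrow> 'a::comm_ring_1) \<Rightarrow> ('g, 'b) monoid_scheme
    \<Rightarrow> ('g \<Rightarrow> ('n::enum \<Rightarrow> int) \<Rightarrow> ('n \<Rightarrow> int)) \<Rightarrow> ('a, 'n) mps set" where
  "invariants c G act = {p. \<forall>g\<in>carrier G. act_ps c act g p = p}"

definition inv_ideal :: "(nat \<Rightarrow> nat \<Rightarrow> 'a::comm_ring_1) \<Rightarrow> ('g, 'b) monoid_scheme
    \<Rightarrow> ('g \<Rightarrow> ('n::enum \<Rightarrow> int) \<Rightarrow> ('n \<Rightarrow> int)) \<Rightarrow> ('a, 'n) mps set" where
  "inv_ideal c G act = {p. \<exists>(k::nat) a s. (\<forall>j<k. s j \<in> invariants c G act \<and> s j (\<lambda>i. 0) = 0) \<and>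
        p = (\<lambda>m. \<Sum>j<k. mps_mult (a j) (s j) m)}"

definition in_aug_pow :: "nat \<Rightarrow> ('a::comm_ring_1, 'n::finite) mps \<Rightarrow> bool" where
  "in_aug_pow d p \<longleftrightarrow> (\<forall>m. mdeg m < d \<longrightarrow> p m = 0)"

text \<open>(I_F^W)^(d), as a subset of I_F^(d) = homogeneous forms of degree d in x_omega_1..x_omega_n
(the class of p in I^d/I^(d+1) is its degree-d homogeneous part).\<close>
definition graded_inv :: "(nat \<Rightarrow> nat \<Rightarrow> 'a::comm_ring_1) \<Rightarrow> ('g, 'b) monoid_scheme
    \<Rightarrow> ('g \<Rightarrow> ('n::enum \<Rightarrow> int) \<Rightarrow> ('n \<Rightarrow> int)) \<Rightarrow> nat \<Rightarrow> ('a, 'n) mps set" where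
  "graded_inv c G act d = {(\<lambda>m. if mdeg m = d then p m else 0) | p.
       p \<in> inv_ideal c G act \<and> in_aug_pow d p}"

text \<open>Phi_d^{F -> F'} sends x_lambda_1 ... x_lambda_d to x_lambda_1 ... x_lambda_d; in the
coordinates x_omega_i both sides have the same degree-d part, so Phi_d is the identity on
homogeneous degree-d forms.\<close>
definition Phi_d :: "(nat \<Rightarrow> nat \<Rightarrow> 'a::comm_ring_1) \<Rightarrow> (nat \<Rightarrow> nat \<Rightarrow> 'a) \<Rightarrow> nat
    \<Rightarrow> ('a, 'n::finite) mps \<Rightarrow> ('a, 'n) mps" where
  "Phi_d c c' d p = (\<lambda>m. if mdeg m = d then p m else 0)"

definition has_finite_exponent :: "(nat \<Rightarrow> nat \<Rightarrow> 'a::comm_ring_1) \<Rightarrow> (nat \<Rightarrow> nat \<Rightarrow> 'a)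
    \<Rightarrow> ('g, 'b) monoid_scheme \<Rightarrow> ('g \<Rightarrow> ('n::enum \<Rightarrow> int) \<Rightarrow> ('n \<Rightarrow> int)) \<Rightarrow> nat \<Rightarrow> bool" where
  "has_finite_exponent c c' G act d \<longleftrightarrow>
     (\<exists>N::nat. N > 0 \<and> (CHAR('a) = 0 \<or> coprime N CHAR('a)) \<and>
        (\<forall>p\<in>graded_inv c' G act d.
           (\<lambda>m. of_nat N * p m) \<in> Phi_d c c' d ` graded_inv c G act d))"

end

theory Submission
  imports Defs "HOL-Algebra.FiniteProduct" "HOL-Library.Function_Algebras"
begin

text \<open>The endomorphism \<psi> of the formal group algebra induced by doubling the lattice commutes with
the group action and acts on the j-th graded piece of the augmentation filtration by 2^j. Hence,
modulo the (d+1)-st step and up to an integer factor depending only on d, every element is a sum of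
\<psi>-eigenvectors, and the components of an invariant element are invariant. If a combination
of invariants lies in the d-th step, separating eigenvalues shows that an integer multiple of its
leading form is a combination of leading forms of invariants, of complementary degrees. The action on
the graded pieces does not depend on the formal group law, so the orbit sum for F of an F'-invariant
element of degree j is F-invariant with the same leading form up to the factor given by the group
order. No division takes place, so torsion in the base ring is harmless.\<close>

section \<open>The ring of power series\<close>

text \<open>Doubling is chosen because it commutes with every additive map of the lattice, so
  nothing has to be known about the group. Its eigenvalues 1, 2, 4, ... on the graded pieces have
  nonzero integer differences, and the exponent is built from these. One integer has to serve all
  elements of the ideal at once. The base ring is arbitrary, so one cannot pick finitely many
  generators and multiply their individual denominators. For this reason every constant is fixed
  before the series and the invariants are given. The eigenvectors are approximate, that is,
  eigenvectors modulo the (d+1)-st step, and congruences modulo this step replace exact equations.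
  Invariants are split by weight because passing from F' to F changes an invariant of order j from
  order j + 1 on, and this is harmless only next to a coefficient of order d - j.\<close>

typedef ('a, 'n) ps = "UNIV :: ('a, 'n) mps set"
  morphisms coeff Ps ..

lemma coeff_Ps [simp]: "coeff (Ps p) = p"
  by (simp add: Ps_inverse)

lemma Ps_coeff [simp]: "Ps (coeff f) = f"
  by (simp add: coeff_inverse)

lemma ps_eqI: "(\<And>m. coeff f m = coeff g m) \<Longrightarrow> f = g"
  by (metis coeff_inject ext)

lemma finite_le_fun: "finite {..m :: 'n::finite \<Rightarrow> nat}"
proof -
  have "{..m} \<subseteq> (UNIV :: 'n set) \<rightarrow>\<^sub>E {..Max (range m)}"
  proof
    fix a assume "a \<in> {..m}"
    then have "a i \<le> Max (range m)" for i
      using Max_ge[of "range m" "m i"] by (auto simp: le_fun_def intro: order_trans)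
    then show "a \<in> UNIV \<rightarrow>\<^sub>E {..Max (range m)}"
      by auto
  qed
  then show ?thesis
    by (rule finite_subset) (simp add: finite_PiE)
qed

lemma finite_antidiagonal: "finite {(a, b). a + b = (m :: 'n::finite \<Rightarrow> nat)}"
proof (rule finite_subset)
  show "{(a, b). a + b = m} \<subseteq> {..m} \<times> {..m}"
    by (auto simp: le_fun_def)
qed (simp add: finite_le_fun)

text \<open>With the symmetric index set, associativity and commutativity of the product become
  reindexings of sums.\<close>

lemma sum_antidiagonal:
  fixes m :: "'n::finite \<Rightarrow> nat"
  shows "(\<Sum>(a, b)\<in>{(a, b). a + b = m}. h a b) = (\<Sum>a\<in>{a. \<forall>i. a i \<le> m i}. h a (\<lambda>i. m i - a i))"
proof (rule sum.reindex_bij_witness[where i = "\<lambda>a. (a, \<lambda>i. m i - a i)" and j = fst])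
  fix p assume "p \<in> {(a, b). a + b = m}"
  then obtain a b where p: "p = (a, b)" and m: "m = a + b"
    by auto
  show "(fst p, \<lambda>i. m i - fst p i) = p" "fst p \<in> {a. \<forall>i. a i \<le> m i}"
    "h (fst p) (\<lambda>i. m i - fst p i) = (case p of (a, b) \<Rightarrow> h a b)"
    by (simp_all add: p m)
qed (auto simp: fun_eq_iff)

instantiation ps :: (comm_ring_1, finite) comm_ring_1
begin

definition "0 = Ps mps_zero"
definition "1 = Ps mps_one"
definition "f + g = Ps (\<lambda>m. coeff f m + coeff g m)"
definition "- f = Ps (\<lambda>m. - coeff f m)"
definition "f - g = Ps (\<lambda>m. coeff f m - coeff g m)"
definition "f * g = Ps (mps_mult (coeff f) (coeff g))"

lemma coeff_0 [simp]: "coeff 0 m = 0"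
  and coeff_1: "coeff 1 m = (if m = 0 then 1 else 0)"
  and coeff_add [simp]: "coeff (f + g) m = coeff f m + coeff g m"
  and coeff_minus [simp]: "coeff (- f) m = - coeff f m"
  and coeff_diff [simp]: "coeff (f - g) m = coeff f m - coeff g m"
  by (simp_all add: zero_ps_def one_ps_def plus_ps_def uminus_ps_def minus_ps_def mps_zero_def
      mps_one_def zero_fun_def)

lemma coeff_mult: "coeff (f * g) m = (\<Sum>(a, b)\<in>{(a, b). a + b = m}. coeff f a * coeff g b)"
  by (simp add: times_ps_def mps_mult_def sum_antidiagonal)

instance
proof
  fix f g h :: "('a, 'b) ps"
  show "f * g * h = f * (g * h)"
  proof (rule ps_eqI)
    fix m
    have "coeff (f * g * h) m = (\<Sum>((a, b), (c, d))\<in>(SIGMA (a, b):{(a, b). a + b = m}. {(c, d). c + d = a}).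
        coeff f c * coeff g d * coeff h b)"
      by (subst sum.Sigma[symmetric])
         (auto simp: coeff_mult sum_distrib_right finite_antidiagonal[unfolded case_prod_unfold] case_prod_unfold)
    also have "\<dots> = (\<Sum>((a, b), (c, d))\<in>(SIGMA (a, b):{(a, b). a + b = m}. {(c, d). c + d = b}).
        coeff f a * (coeff g c * coeff h d))"
      by (rule sum.reindex_bij_witness[where i = "\<lambda>((a, b), (c, d)). ((a + c, d), (a, c))"
            and j = "\<lambda>((a, b), (c, d)). ((c, d + b), (d, b))"]) (auto simp: ac_simps)
    also have "\<dots> = coeff (f * (g * h)) m"
      by (subst sum.Sigma[symmetric])
         (auto simp: coeff_mult sum_distrib_left finite_antidiagonal[unfolded case_prod_unfold] case_prod_unfold)
    finally show "coeff (f * g * h) m = coeff (f * (g * h)) m" .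
  qed
  show "f * g = g * f"
  proof (rule ps_eqI)
    fix m
    show "coeff (f * g) m = coeff (g * f) m"
      unfolding coeff_mult
      by (rule sum.reindex_bij_witness[where i = prod.swap and j = prod.swap]) (auto simp: ac_simps)
  qed
  show "1 * f = f"
  proof (rule ps_eqI)
    fix m
    have "coeff (1 * f) m = (\<Sum>(a, b)\<in>{(0 :: 'b \<Rightarrow> nat, m)}. coeff 1 a * coeff f b)"
      unfolding coeff_mult
      by (rule sum.mono_neutral_right) (auto simp: finite_antidiagonal coeff_1 split: if_splits)
    then show "coeff (1 * f) m = coeff f m"
      by (simp add: coeff_1)
  qed
  show "(f + g) * h = f * h + g * h"
    by (rule ps_eqI) (simp add: coeff_mult distrib_right case_prod_unfold sum.distrib)
  have "coeff (0 :: ('a, 'b) ps) 0 \<noteq> coeff 1 0"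
    by (simp add: coeff_1)
  then show "(0 :: ('a, 'b) ps) \<noteq> 1"
    by metis
  show "f + g + h = f + (g + h)" "f + g = g + f" "0 + f = f" "- f + f = 0" "f - g = f + - g"
    by (rule ps_eqI; simp add: ac_simps)+
qed

end

lemma coeff_sum [simp]: "coeff (sum f A) m = (\<Sum>x\<in>A. coeff (f x) m)"
  by (induction A rule: infinite_finite_induct) simp_all

section \<open>Constants, variables and monomials\<close>

definition const :: "'a::comm_ring_1 \<Rightarrow> ('a, 'n::finite) ps" where
  "const c = Ps (\<lambda>m. if m = 0 then c else 0)"

lemma coeff_const: "coeff (const c) m = (if m = 0 then c else 0)"
  by (simp add: const_def)

lemma coeff_const_mult [simp]:
  fixes f :: "('a::comm_ring_1, 'n::finite) ps"
  shows "coeff (const c * f) m = c * coeff f m"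
proof -
  have "coeff (const c * f) m = (\<Sum>(a, b)\<in>{(0 :: 'n \<Rightarrow> nat, m)}. coeff (const c) a * coeff f b)"
    unfolding coeff_mult
    by (rule sum.mono_neutral_right) (auto simp: finite_antidiagonal coeff_const split: if_splits)
  then show ?thesis
    by (simp add: coeff_const)
qed

lemma const_0 [simp]: "const 0 = 0" and const_1 [simp]: "const 1 = 1"
  by (rule ps_eqI, simp add: coeff_const coeff_1)+

lemma const_mult: "const (a * b) = const a * const b"
  and const_add: "const (a + b) = const a + const b"
  by (rule ps_eqI, simp add: coeff_const)+

lemma of_nat_eq_const: "of_nat n = const (of_nat n)"
  by (induction n) (simp_all add: const_add)

definition var :: "'n::finite \<Rightarrow> ('a::comm_ring_1, 'n) ps" where
  "var i = Ps (mps_X i)"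

definition evec :: "'n \<Rightarrow> 'n \<Rightarrow> nat" where
  "evec i = (\<lambda>j. if j = i then 1 else 0)"

definition mon :: "('n::finite \<Rightarrow> nat) \<Rightarrow> ('a::comm_ring_1, 'n) ps" where
  "mon k = Ps (\<lambda>m. if m = k then 1 else 0)"

lemma coeff_mon: "coeff (mon k) m = (if m = k then 1 else 0)"
  by (simp add: mon_def)

lemma mon_0 [simp]: "mon 0 = 1"
  by (rule ps_eqI) (simp add: coeff_mon coeff_1)

lemma mon_mult: "mon k * mon l = mon (k + l)"
proof (rule ps_eqI)
  fix m
  have "coeff (mon k * mon l :: ('a, 'b) ps) m
      = (\<Sum>p\<in>{(a, b). a + b = m}. if p = (k, l) then 1 else 0)"
    unfolding coeff_mult by (rule sum.cong) (auto simp: coeff_mon split: if_splits)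
  then show "coeff (mon k * mon l :: ('a, 'b) ps) m = coeff (mon (k + l)) m"
    by (auto simp: coeff_mon finite_antidiagonal)
qed

lemma var_eq_mon: "var i = mon (evec i)"
  by (simp add: var_def mon_def mps_X_def evec_def)

lemma mon_power: "mon k ^ n = mon (\<lambda>i. n * k i)"
proof (induction n)
  case 0
  then show ?case by (simp flip: zero_fun_def)
next
  case (Suc n)
  then show ?case by (simp add: mon_mult plus_fun_def)
qed

lemma mon_prod: "finite A \<Longrightarrow> (\<Prod>i\<in>A. mon (h i)) = mon (\<lambda>j. \<Sum>i\<in>A. h i j)"
  by (induction A rule: finite_induct) (simp_all add: mon_mult plus_fun_def flip: zero_fun_def)

lemma mon_eq_prod: "mon m = (\<Prod>i\<in>UNIV. var i ^ m i)"
proof -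
  have "(\<Sum>i\<in>UNIV. m i * evec i j) = m j" for j
    using sum.delta'[of UNIV j m] by (simp add: evec_def mult_ac if_distrib[of "\<lambda>x. _ * x"] cong: if_cong)
  then show ?thesis
    by (simp add: var_eq_mon mon_power mon_prod)
qed

section \<open>The augmentation filtration and continuous homomorphisms\<close>

lemma mdeg_0 [simp]: "mdeg 0 = 0"
  and mdeg_add: "mdeg (k + l) = mdeg k + mdeg l"
  and mdeg_evec [simp]: "mdeg (evec i) = 1"
  by (simp_all add: mdeg_def sum.distrib evec_def)

lemma mdeg_eq_0_iff: "mdeg m = 0 \<longleftrightarrow> m = 0"
  by (auto simp: mdeg_def fun_eq_iff)

lemma finite_mdeg_le: "finite {m :: 'n::finite \<Rightarrow> nat. mdeg m \<le> D}"
proof (rule finite_subset)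
  show "{m :: 'n \<Rightarrow> nat. mdeg m \<le> D} \<subseteq> {..\<lambda>_. D}"
  proof (clarsimp simp: le_fun_def)
    fix m :: "'n \<Rightarrow> nat" and i
    assume "mdeg m \<le> D"
    moreover have "m i \<le> mdeg m"
      unfolding mdeg_def by (rule member_le_sum) auto
    ultimately show "m i \<le> D"
      by simp
  qed
qed (rule finite_le_fun)

lemma finite_mdeg_less: "finite {m :: 'n::finite \<Rightarrow> nat. mdeg m < D}"
  by (rule finite_subset[OF _ finite_mdeg_le[of D]]) auto

text \<open>With finitely many variables, the series without terms of degree below d form the d-th
  power of the augmentation ideal, so \<open>aug d (f - g)\<close> is congruence modulo that
  power.\<close>

definition aug :: "nat \<Rightarrow> ('a::comm_ring_1, 'n::finite) ps \<Rightarrow> bool" where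
  "aug d f \<longleftrightarrow> in_aug_pow d (coeff f)"

lemma aug_iff: "aug d f \<longleftrightarrow> (\<forall>m. mdeg m < d \<longrightarrow> coeff f m = 0)"
  by (simp add: aug_def in_aug_pow_def)

lemma aug_zero_left [simp]: "aug 0 f"
  and aug_0 [simp]: "aug d 0"
  and aug_mono: "aug e f \<Longrightarrow> d \<le> e \<Longrightarrow> aug d f"
  and aug_add: "aug d f \<Longrightarrow> aug d g \<Longrightarrow> aug d (f + g)"
  and aug_diff: "aug d f \<Longrightarrow> aug d g \<Longrightarrow> aug d (f - g)"
  and aug_minus: "aug d f \<Longrightarrow> aug d (- f)"
  by (auto simp: aug_iff)

lemma aug_diff_iff: "aug d (f - g) \<longleftrightarrow> (\<forall>m. mdeg m < d \<longrightarrow> coeff f m = coeff g m)"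
  by (simp add: aug_iff)

lemma aug_diff_sym: "aug d (f - g) \<Longrightarrow> aug d (g - f)"
  by (auto simp: aug_diff_iff)

lemma aug_diff_trans [trans]: "aug d (f - g) \<Longrightarrow> aug d (g - h) \<Longrightarrow> aug d (f - h)"
  by (auto simp: aug_diff_iff)

lemma aug_cong: "aug d (f - g) \<Longrightarrow> aug d f \<longleftrightarrow> aug d g"
  by (auto simp: aug_iff)

lemma aug_sum: "(\<And>x. x \<in> A \<Longrightarrow> aug d (f x)) \<Longrightarrow> aug d (sum f A)"
  by (simp add: aug_iff)

lemma aug_sum_diff:
  "(\<And>x. x \<in> A \<Longrightarrow> aug d (f x - g x)) \<Longrightarrow> aug d (sum f A - sum g A)"
  by (simp add: aug_sum flip: sum_subtractf)

lemma aug_mult: "aug i f \<Longrightarrow> aug j g \<Longrightarrow> aug (i + j) (f * g)"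
  unfolding aug_iff coeff_mult
proof (intro allI impI sum.neutral ballI, clarsimp)
  fix a b :: "'b \<Rightarrow> nat"
  assume "\<forall>m. mdeg m < i \<longrightarrow> coeff f m = 0" "\<forall>m. mdeg m < j \<longrightarrow> coeff g m = 0"
    and "mdeg (a + b) < i + j"
  moreover have "mdeg a < i \<or> mdeg b < j"
    using \<open>mdeg (a + b) < i + j\<close> by (auto simp: mdeg_add)
  ultimately show "coeff f a * coeff g b = 0"
    by auto
qed

lemma aug_mult_left: "aug d g \<Longrightarrow> aug d (f * g)"
  using aug_mult[of 0 f d g] by simp

lemma aug_power: "aug 1 f \<Longrightarrow> aug k (f ^ k)"
  by (induction k) (auto dest: aug_mult)

lemma aug_prod:
  "finite A \<Longrightarrow> (\<And>i. i \<in> A \<Longrightarrow> aug (k i) (f i)) \<Longrightarrow> aug (\<Sum>i\<in>A. k i) (\<Prod>i\<in>A. f i)"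
  by (induction A rule: finite_induct) (auto intro: aug_mult)

text \<open>Here e is precision relative to the orders i and j of the factors. Counting it this way
  preserves it under products, which later gains one order on leading forms.\<close>

lemma aug_mult_diff:
  assumes "aug i f" "aug i f'" "aug j g" "aug (i + e) (f - f')" "aug (j + e) (g - g')"
  shows "aug (i + j + e) (f * g - f' * g')"
proof -
  have "f * g - f' * g' = (f - f') * g + f' * (g - g')"
    by (simp add: algebra_simps)
  then show ?thesis
    using aug_mult[OF assms(4,3)] aug_mult[OF assms(2,5)] by (simp add: ac_simps aug_add)
qed

lemma aug_mult_cong: "aug d (f - f') \<Longrightarrow> aug d (g - g') \<Longrightarrow> aug d (f * g - f' * g')"
  using aug_mult_diff[of 0 f f' 0 g d g'] by simp

lemma aug_power_diff:
  assumes "aug 1 f" "aug 1 f'" "aug (1 + e) (f - f')"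
  shows "aug (k + e) (f ^ k - f' ^ k)"
proof (induction k)
  case (Suc k)
  then show ?case
    using aug_mult_diff[OF assms(1,2) aug_power[OF assms(1)] assms(3) Suc] by simp
qed simp

lemma aug_prod_diff:
  assumes "finite A" "\<And>i. i \<in> A \<Longrightarrow> aug (k i) (f i)" "\<And>i. i \<in> A \<Longrightarrow> aug (k i) (f' i)"
    "\<And>i. i \<in> A \<Longrightarrow> aug (k i + e) (f i - f' i)"
  shows "aug ((\<Sum>i\<in>A. k i) + e) ((\<Prod>i\<in>A. f i) - (\<Prod>i\<in>A. f' i))"
  using assms
proof (induction A rule: finite_induct)
  case (insert x A)
  then show ?case
    using aug_mult_diff[of "k x" "f x" "f' x" "sum k A" "prod f A" e "prod f' A"]
    by (auto intro: aug_prod)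
qed simp

lemma aug_eq_0I: "(\<And>d. aug d f) \<Longrightarrow> f = 0"
  by (rule ps_eqI) (auto simp: aug_iff)

lemma aug_eqI: "(\<And>d. aug d (f - g)) \<Longrightarrow> f = g"
  using aug_eq_0I[of "f - g"] by simp

lemma aug_var [simp]: "aug 1 (var i)"
  by (auto simp: aug_iff var_eq_mon coeff_mon)

section \<open>Truncations and continuous algebra homomorphisms\<close>

definition trunc :: "nat \<Rightarrow> ('a::comm_ring_1, 'n::finite) ps \<Rightarrow> ('a, 'n) ps" where
  "trunc D f = (\<Sum>m\<in>{m. mdeg m < D}. const (coeff f m) * mon m)"

lemma coeff_trunc: "coeff (trunc D f) k = (if mdeg k < D then coeff f k else 0)"
proof -
  have "coeff (trunc D f) k = (\<Sum>m\<in>{m. mdeg m < D}. if k = m then coeff f m else 0)"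
    by (simp add: trunc_def coeff_mon if_distrib[of "\<lambda>x. _ * x"] cong: if_cong)
  then show ?thesis
    by (simp add: finite_mdeg_less)
qed

lemma aug_trunc: "aug D (f - trunc D f)"
  by (simp add: aug_iff coeff_trunc)

text \<open>Preservation of the filtration is continuity: series that agree below degree d have
  images that agree below degree d. Such a map is therefore controlled by its values on truncations,
  that is, on polynomials.\<close>

locale cont_hom =
  fixes \<phi> :: "('a::comm_ring_1, 'm::finite) ps \<Rightarrow> ('a, 'n::finite) ps"
  assumes add: "\<phi> (f + g) = \<phi> f + \<phi> g"
    and mult: "\<phi> (f * g) = \<phi> f * \<phi> g"
    and const: "\<phi> (const c) = const c"
    and aug: "aug d f \<Longrightarrow> aug d (\<phi> f)"
begin

lemma zero [simp]: "\<phi> 0 = 0" and one [simp]: "\<phi> 1 = 1"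
  using const[of 0] const[of 1] by simp_all

lemma diff: "\<phi> (f - g) = \<phi> f - \<phi> g"
  using add[of "f - g" g] by simp

lemma sum: "\<phi> (sum f A) = (\<Sum>x\<in>A. \<phi> (f x))"
  by (induction A rule: infinite_finite_induct) (simp_all add: add)

lemma prod: "\<phi> (prod f A) = (\<Prod>x\<in>A. \<phi> (f x))"
  by (induction A rule: infinite_finite_induct) (simp_all add: mult)

lemma power: "\<phi> (f ^ k) = \<phi> f ^ k"
  by (induction k) (simp_all add: mult)

lemma map_of_nat_mult: "\<phi> (of_nat k * f) = of_nat k * \<phi> f"
  by (simp add: mult const of_nat_eq_const)

lemma cong: "aug d (f - g) \<Longrightarrow> aug d (\<phi> f - \<phi> g)"
  using aug[of d "f - g"] by (simp add: diff)

lemma mon: "\<phi> (mon m) = (\<Prod>i\<in>UNIV. \<phi> (var i) ^ m i)"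
  by (simp add: mon_eq_prod prod power)

lemma trunc: "\<phi> (trunc D f) = (\<Sum>m\<in>{m. mdeg m < D}. const (coeff f m) * (\<Prod>i\<in>UNIV. \<phi> (var i) ^ m i))"
  by (simp add: trunc_def sum mult const mon)

end

lemma cont_hom_compose: "cont_hom \<phi> \<Longrightarrow> cont_hom \<psi> \<Longrightarrow> cont_hom (\<lambda>f. \<phi> (\<psi> f))"
  by (simp add: cont_hom_def)

text \<open>The maps agree on truncations, and by continuity their difference lies in every step of
  the filtration, hence is zero.\<close>

lemma cont_hom_eqI:
  assumes "cont_hom \<phi>" "cont_hom \<psi>" "\<And>i. \<phi> (var i) = \<psi> (var i)"
  shows "\<phi> f = \<psi> f"
proof (rule aug_eqI)
  fix D
  have "\<phi> (trunc D f) = \<psi> (trunc D f)"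
    by (simp add: cont_hom.trunc assms)
  then show "aug D (\<phi> f - \<psi> f)"
    using cont_hom.cong[OF assms(1) aug_trunc[of D f]] cont_hom.cong[OF assms(2) aug_trunc[of D f]]
    by (metis aug_diff_sym aug_diff_trans)
qed

text \<open>The image of a leading form is governed by the linear parts of the images of the
  variables. This serves twice: to compare doubling with exact scaling, and to compare the actions
  for two formal group laws.\<close>

lemma cont_hom_leading_cong:
  assumes "cont_hom \<phi>" "cont_hom \<psi>" "\<And>i. aug 2 (\<phi> (var i) - \<psi> (var i))" "aug d f"
  shows "aug (d + 1) (\<phi> f - \<psi> f)"
proof -
  interpret \<phi>: cont_hom \<phi> by fact
  interpret \<psi>: cont_hom \<psi> by fact
  have "aug (d + 1) (\<phi> (trunc (d + 1) f) - \<psi> (trunc (d + 1) f))"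
    unfolding \<phi>.trunc \<psi>.trunc
  proof (rule aug_sum_diff)
    fix m :: "'b \<Rightarrow> nat"
    assume "m \<in> {m. mdeg m < d + 1}"
    then consider "mdeg m < d" | "mdeg m = d" by force
    then show "aug (d + 1) (const (coeff f m) * (\<Prod>i\<in>UNIV. \<phi> (var i) ^ m i)
      - const (coeff f m) * (\<Prod>i\<in>UNIV. \<psi> (var i) ^ m i))"
    proof cases
      case 1
      then show ?thesis
        using assms(4) by (simp add: aug_iff)
    next
      case 2
      \<comment> \<open>Each factor changes only at relative precision 1, so the image of a monomial
        of degree d changes only from order d + 1 on.\<close>
      have "aug ((\<Sum>i\<in>UNIV. m i) + 1) ((\<Prod>i\<in>UNIV. \<phi> (var i) ^ m i) - (\<Prod>i\<in>UNIV. \<psi> (var i) ^ m i))"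
        using assms(3)
        by (intro aug_prod_diff aug_power aug_power_diff \<phi>.aug \<psi>.aug) (auto simp: numeral_2_eq_2 aug_var[unfolded One_nat_def])
      then show ?thesis
        using 2 aug_mult_left[of "d + 1" _ "const (coeff f m)"]
        by (simp add: mdeg_def flip: right_diff_distrib)
    qed
  qed
  then show ?thesis
    using \<phi>.cong[OF aug_trunc[of "d + 1" f]] \<psi>.cong[OF aug_trunc[of "d + 1" f]]
    by (meson aug_diff_sym aug_diff_trans)
qed

text \<open>The variable sets may differ, so that the three-variable associativity axiom can be
  carried to arbitrary series. The finite range suffices once the \<sigma> i have no constant
  term.\<close>

definition gsubst :: "('m::finite \<Rightarrow> ('a::comm_ring_1, 'n::finite) ps) \<Rightarrow> ('a, 'm) ps \<Rightarrow> ('a, 'n) ps" where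
  "gsubst \<sigma> f = Ps (\<lambda>k. \<Sum>m\<in>{m. mdeg m \<le> mdeg k}. coeff f m * coeff (\<Prod>i\<in>UNIV. \<sigma> i ^ m i) k)"

context
  fixes \<sigma> :: "'m::finite \<Rightarrow> ('a::comm_ring_1, 'n::finite) ps"
  assumes \<sigma>: "\<And>i. aug 1 (\<sigma> i)"
begin

lemma aug_prod_power: "aug (mdeg m) (\<Prod>i\<in>UNIV. \<sigma> i ^ m i)"
  unfolding mdeg_def using \<sigma> by (intro aug_prod aug_power) auto

lemma gsubst_add: "gsubst \<sigma> (f + g) = gsubst \<sigma> f + gsubst \<sigma> g"
  by (rule ps_eqI) (simp add: gsubst_def distrib_right sum.distrib)

lemma gsubst_sum: "finite A \<Longrightarrow> gsubst \<sigma> (sum h A) = (\<Sum>x\<in>A. gsubst \<sigma> (h x))"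
proof (induction A rule: finite_induct)
  case empty
  show ?case by (rule ps_eqI) (simp add: gsubst_def)
qed (simp add: gsubst_add)

lemma gsubst_const_mon: "gsubst \<sigma> (const c * mon m) = const c * (\<Prod>i\<in>UNIV. \<sigma> i ^ m i)"
proof (rule ps_eqI)
  fix k
  have "coeff (gsubst \<sigma> (const c * mon m)) k
    = (\<Sum>l\<in>{l. mdeg l \<le> mdeg k}. if l = m then c * coeff (\<Prod>i\<in>UNIV. \<sigma> i ^ m i) k else 0)"
    unfolding gsubst_def coeff_Ps by (rule sum.cong) (auto simp: coeff_mon)
  then show "coeff (gsubst \<sigma> (const c * mon m)) k = coeff (const c * (\<Prod>i\<in>UNIV. \<sigma> i ^ m i)) k"
    using aug_prod_power[of m] by (simp add: finite_mdeg_le aug_iff)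
qed

lemma gsubst_aug: "aug d f \<Longrightarrow> aug d (gsubst \<sigma> f)"
  by (simp add: aug_iff gsubst_def)

text \<open>On polynomials this is the distributive law, and modulo each step of the filtration
  every series is a polynomial.\<close>

lemma gsubst_mult: "gsubst \<sigma> (f * g) = gsubst \<sigma> f * gsubst \<sigma> g"
proof (rule aug_eqI)
  fix D
  have trunc: "gsubst \<sigma> (trunc D f) = (\<Sum>m\<in>{m. mdeg m < D}. const (coeff f m) * (\<Prod>i\<in>UNIV. \<sigma> i ^ m i))" for f
    by (simp add: trunc_def gsubst_sum gsubst_const_mon finite_mdeg_less)
  have cong: "aug D (gsubst \<sigma> f - gsubst \<sigma> g)" if "aug D (f - g)" for f g
    using gsubst_aug[OF that] gsubst_add[of "f - g" g] by simp
  have "trunc D f * trunc D g = (\<Sum>m\<in>{m. mdeg m < D}. \<Sum>l\<in>{m. mdeg m < D}.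
      const (coeff f m * coeff g l) * mon (m + l))"
    unfolding trunc_def sum_product by (simp add: const_mult ac_simps flip: mon_mult)
  then have "gsubst \<sigma> (trunc D f * trunc D g) = (\<Sum>m\<in>{m. mdeg m < D}. \<Sum>l\<in>{m. mdeg m < D}.
      const (coeff f m * coeff g l) * (\<Prod>i\<in>UNIV. \<sigma> i ^ (m + l) i))"
    by (simp add: gsubst_sum finite_mdeg_less gsubst_const_mon)
  also have "\<dots> = gsubst \<sigma> (trunc D f) * gsubst \<sigma> (trunc D g)"
    unfolding trunc sum_product by (simp add: const_mult power_add prod.distrib ac_simps)
  finally have *: "gsubst \<sigma> (trunc D f * trunc D g) = gsubst \<sigma> (trunc D f) * gsubst \<sigma> (trunc D g)" .
  have "aug D (gsubst \<sigma> (f * g) - gsubst \<sigma> (trunc D f * trunc D g))"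
    by (intro cong aug_mult_cong aug_trunc)
  also have "aug D (gsubst \<sigma> (trunc D f * trunc D g) - gsubst \<sigma> f * gsubst \<sigma> g)"
    unfolding * by (intro aug_mult_cong cong aug_diff_sym[OF aug_trunc])
  finally show "aug D (gsubst \<sigma> (f * g) - gsubst \<sigma> f * gsubst \<sigma> g)" .
qed

lemma cont_hom_gsubst: "cont_hom (gsubst \<sigma>)"
proof
  show "gsubst \<sigma> (const c) = const c" for c
    using gsubst_const_mon[of c 0] by simp
qed (simp_all add: gsubst_add gsubst_mult gsubst_aug)

lemma gsubst_var [simp]: "gsubst \<sigma> (var i) = \<sigma> i"
proof -
  have "(\<Prod>j\<in>UNIV. \<sigma> j ^ evec i j) = (\<Prod>j\<in>UNIV. if j = i then \<sigma> j else 1)"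
    by (rule prod.cong) (auto simp: evec_def)
  then show ?thesis
    using gsubst_const_mon[of 1 "evec i"] by (simp add: var_eq_mon)
qed

end

section \<open>Formal sums\<close>

lemma mps_pow_coeff: "mps_pow (coeff f) k = coeff (f ^ k)"
  by (induction k) (simp_all add: one_ps_def times_ps_def)

definition fsum :: "(nat \<Rightarrow> nat \<Rightarrow> 'a::comm_ring_1) \<Rightarrow> ('a, 'n::finite) ps \<Rightarrow> ('a, 'n) ps \<Rightarrow> ('a, 'n) ps" where
  "fsum c f g = Ps (subst2 c (coeff f) (coeff g))"

lemma subst2_coeff: "subst2 c (coeff f) (coeff g) = coeff (fsum c f g)"
  by (simp add: fsum_def)

lemma coeff_fsum: "coeff (fsum c f g) m
    = (\<Sum>(i, j)\<in>{(i, j). i + j \<le> mdeg m}. c i j * coeff (f ^ i * g ^ j) m)"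
  by (simp add: fsum_def subst2_def mps_pow_coeff case_prod_unfold times_ps_def)

lemma finite_add_less: "finite {(i, j). i + j < (D::nat)}"
  by (rule finite_subset[of _ "{..D} \<times> {..D}"]) auto

text \<open>The range of summation in \<open>coeff_fsum\<close> depends on the monomial. Below
  degree D one fixed range works, since the added products have order above the degree of the
  monomial. Formal sums thus become polynomials, to which homomorphisms can be applied.\<close>

lemma fsum_approx:
  assumes "aug 1 f" "aug 1 g"
  shows "aug D (fsum c f g - (\<Sum>(i, j)\<in>{(i, j). i + j < D}. const (c i j) * (f ^ i * g ^ j)))"
  unfolding aug_diff_iff
proof (intro allI impI)
  fix m :: "'b \<Rightarrow> nat"
  assume D: "mdeg m < D"
  have "aug (i + j) (f ^ i * g ^ j)" for i j
    by (intro aug_mult aug_power assms)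
  then have "coeff (f ^ i * g ^ j) m = 0" if "\<not> i + j \<le> mdeg m" for i j
    using that by (simp add: aug_iff not_le)
  then have "(\<Sum>(i, j)\<in>{(i, j). i + j \<le> mdeg m}. c i j * coeff (f ^ i * g ^ j) m)
      = (\<Sum>(i, j)\<in>{(i, j). i + j < D}. c i j * coeff (f ^ i * g ^ j) m)"
    using D by (intro sum.mono_neutral_left) (auto simp: finite_add_less, metis mult_zero_right)
  then show "coeff (fsum c f g) m
      = coeff (\<Sum>(i, j)\<in>{(i, j). i + j < D}. const (c i j) * (f ^ i * g ^ j)) m"
    by (simp add: coeff_fsum case_prod_unfold)
qed

lemma (in cont_hom) fsum:
  assumes "aug 1 f" "aug 1 g"
  shows "\<phi> (fsum c f g) = fsum c (\<phi> f) (\<phi> g)"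
proof (rule aug_eqI)
  fix D
  let ?S = "\<lambda>f g. \<Sum>(i, j)\<in>{(i, j). i + j < D}. const (c i j) * (f ^ i * g ^ j)"
  have "aug D (\<phi> (fsum c f g) - \<phi> (?S f g))"
    by (intro cong fsum_approx assms)
  also have "\<phi> (?S f g) = ?S (\<phi> f) (\<phi> g)"
    by (simp add: sum case_prod_unfold mult const power)
  also have "aug D (?S (\<phi> f) (\<phi> g) - fsum c (\<phi> f) (\<phi> g))"
    by (intro aug_diff_sym[OF fsum_approx] aug assms)
  finally show "aug D (\<phi> (fsum c f g) - fsum c (\<phi> f) (\<phi> g))" .
qed

section \<open>The abelian group of series without constant term under formal addition\<close>

definition fgroup :: "(nat \<Rightarrow> nat \<Rightarrow> 'a::comm_ring_1) \<Rightarrow> ('a, 'n::finite) ps monoid" where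
  "fgroup c = \<lparr>carrier = {f. aug 1 f}, mult = fsum c, one = 0\<rparr>"

lemma carrier_fgroup [simp]: "f \<in> carrier (fgroup c) \<longleftrightarrow> aug 1 f"
  and mult_fgroup [simp]: "mult (fgroup c) = fsum c"
  and one_fgroup [simp]: "one (fgroup c) = 0"
  by (simp_all add: fgroup_def)

locale formal_group_law =
  fixes c :: "nat \<Rightarrow> nat \<Rightarrow> 'a::comm_ring_1"
  assumes fgl: "fgl c"
begin

lemma coeff_left: "c i 0 = (if i = 1 then 1 else 0)"
  and coeff_right: "c 0 j = (if j = 1 then 1 else 0)"
  and coeff_sym: "c i j = c j i"
  and fsum_assoc_var: "fsum c (fsum c (var (0::3)) (var 1)) (var 2)
    = fsum c (var 0) (fsum c (var 1) (var 2))"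
proof -
  show "c i 0 = (if i = 1 then 1 else 0)" "c 0 j = (if j = 1 then 1 else 0)" "c i j = c j i"
    using fgl unfolding fgl_def by blast+
  show "fsum c (fsum c (var (0::3)) (var 1)) (var 2) = fsum c (var 0) (fsum c (var 1) (var 2))"
    using fgl by (simp add: fgl_def fsum_def var_def)
qed

lemma fsum_commute: "fsum c f g = fsum c g f"
proof (rule ps_eqI)
  fix m
  show "coeff (fsum c f g) m = coeff (fsum c g f) m"
    unfolding coeff_fsum
    by (rule sum.reindex_bij_witness[where i = prod.swap and j = prod.swap])
       (auto simp: ac_simps, metis coeff_sym)
qed

lemma aug_fsum: "aug 1 (fsum c f g)"
proof -
  have "{(i, j). i = (0::nat) \<and> j = (0::nat)} = {(0, 0)}"
    by auto
  then show ?thesis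
    by (simp add: aug_iff coeff_fsum mdeg_eq_0_iff coeff_left)
qed

lemma fsum_0_right [simp]:
  assumes "aug 1 f"
  shows "fsum c f 0 = f"
proof (rule aug_eqI)
  fix D :: nat
  \<comment> \<open>The bound D + 2 keeps the index (1, 0) in range even for D = 0.\<close>
  let ?I = "{(i, j). i + j < D + 2}"
  have "aug (D + 2) (fsum c f 0 - (\<Sum>(i, j)\<in>?I. const (c i j) * (f ^ i * 0 ^ j)))"
    by (intro fsum_approx assms) simp
  also have "(\<Sum>(i, j)\<in>?I. const (c i j) * (f ^ i * 0 ^ j)) = (\<Sum>p\<in>?I. if p = (1, 0) then f else 0)"
    by (intro sum.cong) (auto simp: coeff_left power_0_left split: if_splits)
  also have "\<dots> = f"
    using finite_add_less[of "D + 2"] by (subst sum.delta) auto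
  finally show "aug D (fsum c f 0 - f)"
    by (rule aug_mono) simp
qed

text \<open>To first order the derivative in the second argument is 1: every mixed term carries a
  factor of \<open>f\<close> and thereby gains one order, and the only other term containing the
  second argument is linear.\<close>

lemma fsum_diff_right:
  assumes "aug 1 f" "aug 1 g" "aug 1 g'" "aug (d + 1) (g - g')"
  shows "aug (d + 2) (fsum c f g - fsum c f g' - (g - g'))"
proof -
  let ?I = "{(i, j). i + j < d + 2}"
  let ?S = "\<lambda>g. \<Sum>(i, j)\<in>?I. const (c i j) * (f ^ i * g ^ j)"
  have "aug (d + 2) ((\<Sum>(i, j)\<in>?I. const (c i j) * (f ^ i * g ^ j) - const (c i j) * (f ^ i * g' ^ j))
      - (\<Sum>p\<in>?I. if p = (0, 1) then g - g' else 0))"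
  proof (rule aug_sum_diff, clarify)
    fix i j
    have "aug (d + 2) (f ^ i * g ^ j - f ^ i * g' ^ j)" if "i \<noteq> 0" "j \<noteq> 0"
    proof -
      have "aug (j + d) (g ^ j - g' ^ j)"
        using assms by (intro aug_power_diff) (auto simp: add.commute)
      then have "aug (i + j + d) (f ^ i * g ^ j - f ^ i * g' ^ j)"
        by (intro aug_mult_diff) (auto intro: aug_power assms)
      then show ?thesis
        by (rule aug_mono) (use that in auto)
    qed
    then have "aug (d + 2) (const (c i j) * (f ^ i * g ^ j - f ^ i * g' ^ j))" if "i \<noteq> 0" "j \<noteq> 0"
      using that by (intro aug_mult_left) auto
    then show "aug (d + 2) (const (c i j) * (f ^ i * g ^ j) - const (c i j) * (f ^ i * g' ^ j)
        - (if (i, j) = (0, 1) then g - g' else 0))"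
      by (cases "i = 0"; cases "j = 0") (auto simp: coeff_right right_diff_distrib)
  qed
  also have "(\<Sum>p\<in>?I. if p = (0, 1) then g - g' else 0) = g - g'"
    using finite_add_less[of "d + 2"] by (subst sum.delta) auto
  finally have 1: "aug (d + 2) (?S g - ?S g' - (g - g'))"
    by (simp add: case_prod_unfold sum_subtractf)
  have 2: "aug (d + 2) ((fsum c f g - ?S g) - (fsum c f g' - ?S g'))"
    by (rule aug_diff; rule fsum_approx; fact)
  have "(a - s) - (b - t) + (s - t - u) = a - b - u" for a b s t u :: "('a, 'b) ps"
    by simp
  then show ?thesis
    using aug_add[OF 2 1] by (simp only:)
qed

lemma fsum_cong_right:
  assumes "aug 1 f" "aug 1 g" "aug 1 g'" "aug (d + 1) (g - g')"
  shows "aug (d + 1) (fsum c f g - fsum c f g')"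
proof -
  have "aug (d + 1) (fsum c f g - fsum c f g' - (g - g'))"
    by (rule aug_mono[OF fsum_diff_right[OF assms]]) simp
  from aug_add[OF this assms(4)] show ?thesis
    by simp
qed

lemma fsum_linear: "aug 1 f \<Longrightarrow> aug 1 g \<Longrightarrow> aug 2 (fsum c f g - (f + g))"
  using fsum_diff_right[of f g 0 0] by (simp add: diff_diff_eq numeral_2_eq_2)

text \<open>The axiom is a single identity in three variables; the continuous homomorphism sending
  these to f, g and h turns it into the general law.\<close>

lemma fsum_assoc:
  fixes f g h :: "('a, 'n::finite) ps"
  assumes "aug 1 f" "aug 1 g" "aug 1 h"
  shows "fsum c (fsum c f g) h = fsum c f (fsum c g h)"
proof -
  define \<sigma> where "\<sigma> = (\<lambda>i::3. if i = 0 then f else if i = 1 then g else h)"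
  have \<sigma>: "aug 1 (\<sigma> i)" for i
    using assms by (simp add: \<sigma>_def)
  interpret cont_hom "gsubst \<sigma>"
    by (rule cont_hom_gsubst[OF \<sigma>])
  have "\<sigma> 0 = f" "\<sigma> 1 = g" "\<sigma> 2 = h"
    by (simp_all add: \<sigma>_def)
  moreover have "gsubst \<sigma> (fsum c (fsum c (var 0) (var 1)) (var 2))
      = fsum c (fsum c (\<sigma> 0) (\<sigma> 1)) (\<sigma> 2)"
    by (subst fsum fsum[of "var 0"], (rule aug_fsum aug_var)+)+ (simp only: gsubst_var[OF \<sigma>])
  moreover have "gsubst \<sigma> (fsum c (var 0) (fsum c (var 1) (var 2)))
      = fsum c (\<sigma> 0) (fsum c (\<sigma> 1) (\<sigma> 2))"
    by (subst fsum, (rule aug_fsum aug_var)+)+ (simp only: gsubst_var[OF \<sigma>])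
  ultimately show ?thesis
    by (simp only: fsum_assoc_var)
qed

text \<open>Newton-like iteration: subtracting the defect raises its order.\<close>

lemma fsum_inverse_exists:
  assumes f: "aug 1 f"
  shows "\<exists>g. aug 1 g \<and> fsum c f g = 0"
proof -
  define q where "q = rec_nat 0 (\<lambda>_ g. g - fsum c f g)"
  have q_Suc: "q (Suc k) = q k - fsum c f (q k)" and q_0: "q 0 = 0" for k
    by (simp_all add: q_def)
  have aug_q: "aug 1 (q k)" for k
    by (induction k) (auto simp: q_0 q_Suc intro!: aug_diff aug_fsum[unfolded One_nat_def])
  have defect: "aug (k + 1) (fsum c f (q k))" for k
  proof (induction k)
    case 0
    then show ?case using aug_fsum by simp
  next
    case (Suc k)
    then have "aug (k + 2) (fsum c f (q (Suc k)) - fsum c f (q k) - (q (Suc k) - q k))"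
      by (intro fsum_diff_right f aug_q) (simp add: q_Suc aug_minus)
    then show ?case
      by (simp add: q_Suc)
  qed
  have step: "aug (k + 1) (q (k + e) - q k)" for k e
  proof (induction e)
    case (Suc e)
    have "aug (k + 1) (q (Suc (k + e)) - q (k + e))"
      using aug_mono[OF defect[of "k + e"], of "k + 1"] by (simp add: q_Suc aug_minus)
    then show ?case
      using Suc aug_diff_trans by simp
  qed simp
  \<comment> \<open>From stage k on the iterates agree below degree k + 1, so a coefficient of
    degree k can be read off at stage k.\<close>
  define g where "g = Ps (\<lambda>m. coeff (q (mdeg m)) m)"
  have g: "aug (k + 1) (g - q k)" for k
    unfolding aug_diff_iff
  proof (intro allI impI)
    fix m :: "'b \<Rightarrow> nat"
    assume "mdeg m < k + 1"
    then obtain e where "k = mdeg m + e"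
      using le_Suc_ex[of "mdeg m" k] by auto
    then show "coeff g m = coeff (q k) m"
      using step[of "mdeg m" e] by (simp add: g_def aug_diff_iff)
  qed
  have aug_g: "aug 1 g"
    using g[of 0] by (simp add: q_0)
  have "fsum c f g = 0"
  proof (rule aug_eq_0I)
    fix d
    have "aug (d + 1) (fsum c f g - fsum c f (q d))"
      by (intro fsum_cong_right f aug_g aug_q g)
    then have "aug (d + 1) (fsum c f g)"
      using defect[of d] aug_cong by blast
    then show "aug d (fsum c f g)"
      by (rule aug_mono) simp
  qed
  then show ?thesis
    using aug_g by blast
qed

lemma comm_group_fgroup: "comm_group (fgroup c :: ('a, 'n::finite) ps monoid)"
proof (rule comm_groupI)
  fix f :: "('a, 'n) ps"
  assume "f \<in> carrier (fgroup c)"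
  then show "\<exists>g\<in>carrier (fgroup c). g \<otimes>\<^bsub>fgroup c\<^esub> f = \<one>\<^bsub>fgroup c\<^esub>"
    using fsum_inverse_exists[of f] by (auto simp: fsum_commute)
next
  fix f :: "('a, 'n) ps"
  assume "f \<in> carrier (fgroup c)"
  then show "\<one>\<^bsub>fgroup c\<^esub> \<otimes>\<^bsub>fgroup c\<^esub> f = f"
    using fsum_0_right[of f] by (simp add: fsum_commute)
next
  fix f g :: "('a, 'n) ps"
  show "f \<otimes>\<^bsub>fgroup c\<^esub> g = g \<otimes>\<^bsub>fgroup c\<^esub> f"
    by (simp add: fsum_commute)
next
  fix f g h :: "('a, 'n) ps"
  assume "f \<in> carrier (fgroup c)" "g \<in> carrier (fgroup c)" "h \<in> carrier (fgroup c)"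
  then show "f \<otimes>\<^bsub>fgroup c\<^esub> g \<otimes>\<^bsub>fgroup c\<^esub> h
      = f \<otimes>\<^bsub>fgroup c\<^esub> (g \<otimes>\<^bsub>fgroup c\<^esub> h)"
    by (simp add: fsum_assoc)
next
  show "f \<otimes>\<^bsub>fgroup c\<^esub> g \<in> carrier (fgroup c)" for f g :: "('a, 'n) ps"
    unfolding mult_fgroup carrier_fgroup by (rule aug_fsum)
qed simp

end

section \<open>The elements of a lattice as formal sums\<close>

context comm_group
begin

text \<open>The lattice is free on the unit vectors. The group is abstract because the formula is
  applied both to formal addition and to ordinary addition of linear parts.\<close>

lemma additive_eq_finprod:
  fixes h :: "('n::finite \<Rightarrow> int) \<Rightarrow> 'a" and lam :: "'n \<Rightarrow> int"
  assumes add: "\<And>x y. h (x + y) = h x \<otimes> h y" and closed: "\<And>x. h x \<in> carrier G"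
  shows "h lam = (\<Otimes>i\<in>UNIV. h (unitvec i) [^] lam i)"
proof -
  have zero: "h 0 = \<one>"
    using add[of 0 0] closed[of 0] by (metis add.right_neutral r_cancel_one')
  define s where "s = (\<lambda>i (k::int) j::'n. if j = i then k else 0)"
  have single: "h (s i k) = h (unitvec i) [^] k" for i k
  proof -
    have step: "s i (k + 1) = s i k + unitvec i" for k
      by (auto simp: s_def unitvec_def fun_eq_iff)
    show ?thesis
    proof (induction k rule: int_induct[where k = 0])
      case base
      have "s i 0 = 0" by (auto simp: s_def fun_eq_iff)
      then show ?case by (simp only: zero int_pow_0)
    next
      case (step1 k)
      then have "h (s i (k + 1)) = h (unitvec i) [^] k \<otimes> h (unitvec i) [^] (1 :: int)"
        by (simp only: step add) (simp add: closed)
      then show ?case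
        by (simp only: int_pow_mult closed)
    next
      case (step2 k)
      have "h (s i (k - 1)) \<otimes> h (unitvec i) = h (s i k)"
        using step[of "k - 1"] by (simp only: add diff_add_cancel)
      also have "\<dots> = h (unitvec i) [^] (k - 1) \<otimes> h (unitvec i)"
        using step2 int_pow_mult[of "h (unitvec i)" "k - 1" 1] by (simp add: closed)
      finally show ?case
        by (simp add: closed)
    qed
  qed
  have "h (\<lambda>i. if i \<in> A then lam i else 0) = (\<Otimes>i\<in>A. h (unitvec i) [^] lam i)" for A
    using finite[of A]
  proof (induction A rule: finite_induct)
    case empty
    then show ?case using zero by (simp add: zero_fun_def)
  next
    case (insert a A)
    have "(\<lambda>i. if i \<in> insert a A then lam i else 0) = s a (lam a) + (\<lambda>i. if i \<in> A then lam i else 0)"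
      using insert.hyps by (auto simp: s_def fun_eq_iff)
    then show ?case
      using insert by (simp add: add single closed)
  qed
  from this[of UNIV] show ?thesis
    by simp
qed

end

text \<open>As a product in an abelian group, x_lambda is independent of the order of the basis, and
  its multiples obey the laws of group powers.\<close>

definition xlp :: "(nat \<Rightarrow> nat \<Rightarrow> 'a::comm_ring_1) \<Rightarrow> ('n::finite \<Rightarrow> int) \<Rightarrow> ('a, 'n) ps" where
  "xlp c lam = (\<Otimes>\<^bsub>fgroup c\<^esub>i\<in>UNIV. var i [^]\<^bsub>fgroup c\<^esub> lam i)"

context formal_group_law
begin

text \<open>Existence and uniqueness of group inverses make the definite description in
  \<open>fgl_neg\<close> meaningful.\<close>

lemma fgl_neg_coeff:
  fixes f :: "('a, 'n::finite) ps"
  assumes "aug 1 f"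
  shows "fgl_neg c (coeff f) = coeff (inv\<^bsub>fgroup c\<^esub> f)"
proof -
  interpret comm_group "fgroup c :: ('a, 'n) ps monoid"
    by (rule comm_group_fgroup)
  have aug_1_iff: "aug 1 f \<longleftrightarrow> coeff f (\<lambda>i. 0) = 0" for f :: "('a, 'n) ps"
    by (simp add: aug_iff mdeg_eq_0_iff zero_fun_def)
  have zero: "coeff 0 = mps_zero"
    by (simp add: mps_zero_def fun_eq_iff)
  show ?thesis
    unfolding fgl_neg_def
  proof (rule the_equality)
    have "inv\<^bsub>fgroup c\<^esub> f \<in> carrier (fgroup c)" "fsum c f (inv\<^bsub>fgroup c\<^esub> f) = 0"
      using r_inv[of f] inv_closed[of f] assms by simp_all
    then show "coeff (inv\<^bsub>fgroup c\<^esub> f) (\<lambda>i. 0) = 0 \<and> subst2 c (coeff f) (coeff (inv\<^bsub>fgroup c\<^esub> f)) = mps_zero"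
      by (simp add: aug_1_iff subst2_coeff zero del: One_nat_def)
  next
    fix q
    assume q: "q (\<lambda>i. 0) = 0 \<and> subst2 c (coeff f) q = mps_zero"
    then have "aug 1 (Ps q)" "fsum c f (Ps q) = 0"
      by (simp_all add: aug_1_iff fsum_def zero_ps_def del: One_nat_def)
    then have "Ps q = inv\<^bsub>fgroup c\<^esub> f"
      using assms inv_equality[of "Ps q" f] by (simp add: fsum_commute)
    then show "q = coeff (inv\<^bsub>fgroup c\<^esub> f)"
      by (metis coeff_Ps)
  qed
qed

lemma fgl_imul_coeff:
  fixes f :: "('a, 'n::finite) ps"
  assumes "aug 1 f"
  shows "fgl_imul c k (coeff f) = coeff (f [^]\<^bsub>fgroup c\<^esub> k)"
proof -
  interpret comm_group "fgroup c :: ('a, 'n) ps monoid"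
    by (rule comm_group_fgroup)
  have zero: "mps_zero = coeff (0 :: ('a, 'n) ps)"
    by (simp add: mps_zero_def fun_eq_iff)
  have nmul: "fgl_nmul c n (coeff f) = coeff (f [^]\<^bsub>fgroup c\<^esub> n)" for n and f :: "('a, 'n) ps"
    by (induction n) (simp_all add: subst2_coeff zero)
  have f: "f \<in> carrier (fgroup c)"
    using assms by simp
  show ?thesis
  proof (cases "k \<ge> 0")
    case True
    then have "f [^]\<^bsub>fgroup c\<^esub> k = f [^]\<^bsub>fgroup c\<^esub> nat k"
      by (simp only: int_pow_def2 not_less[symmetric] if_False)
    with True show ?thesis
      by (simp only: fgl_imul_def nmul if_True)
  next
    case False
    then have "f [^]\<^bsub>fgroup c\<^esub> k = inv\<^bsub>fgroup c\<^esub> (f [^]\<^bsub>fgroup c\<^esub> nat (- k))"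
      by (simp only: int_pow_def2 not_le if_True)
    with False show ?thesis
      using nat_pow_inv[OF f, of "nat (- k)"]
      by (simp only: fgl_imul_def fgl_neg_coeff[OF assms] nmul if_False)
  qed
qed

lemma xl_eq: "xl c lam = coeff (xlp c lam)" for lam :: "'n::enum \<Rightarrow> int"
proof -
  interpret comm_group "fgroup c :: ('a, 'n) ps monoid"
    by (rule comm_group_fgroup)
  let ?x = "\<lambda>i. var i [^]\<^bsub>fgroup c\<^esub> lam i :: ('a, 'n) ps"
  have x: "?x i \<in> carrier (fgroup c)" for i
    by (intro int_pow_closed) (simp del: One_nat_def)
  have "foldr (\<lambda>i acc. subst2 c acc (fgl_imul c (lam i) (mps_X i))) xs mps_zero
      = coeff (finprod (fgroup c) ?x (set xs))" if "distinct xs" for xs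
    using that
  proof (induction xs)
    case Nil
    then show ?case by (simp add: mps_zero_def fun_eq_iff)
  next
    case (Cons i xs)
    have "finprod (fgroup c) ?x (insert i (set xs)) = ?x i \<otimes>\<^bsub>fgroup c\<^esub> finprod (fgroup c) ?x (set xs)"
      using Cons.prems x by (intro finprod_insert) auto
    also have "\<dots> = fsum c (finprod (fgroup c) ?x (set xs)) (?x i)"
      by (simp only: mult_fgroup fsum_commute)
    finally have "finprod (fgroup c) ?x (set (i # xs)) = fsum c (finprod (fgroup c) ?x (set xs)) (?x i)"
      by simp
    moreover have "fgl_imul c (lam i) (mps_X i) = coeff (?x i)"
      using fgl_imul_coeff[OF aug_var[of i], of "lam i"] by (simp add: var_def)
    ultimately show ?case
      using Cons by (simp add: subst2_coeff)
  qed
  then show ?thesis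
    by (simp add: xl_def xlp_def enum_distinct UNIV_enum)
qed

lemma aug_xlp: "aug 1 (xlp c lam :: ('a, 'n::finite) ps)"
proof -
  interpret comm_group "fgroup c :: ('a, 'n) ps monoid"
    by (rule comm_group_fgroup)
  have "xlp c lam \<in> carrier (fgroup c :: ('a, 'n) ps monoid)"
    unfolding xlp_def by (intro finprod_closed Pi_I int_pow_closed) (simp del: One_nat_def)
  then show ?thesis
    by simp
qed

lemma xlp_add: "xlp c (lam + mu) = fsum c (xlp c lam) (xlp c mu)" for lam mu :: "'n::finite \<Rightarrow> int"
proof -
  interpret comm_group "fgroup c :: ('a, 'n) ps monoid"
    by (rule comm_group_fgroup)
  have v: "(var i :: ('a, 'n) ps) \<in> carrier (fgroup c)" for i
    by (simp del: One_nat_def)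
  have "xlp c (lam + mu) = (\<Otimes>\<^bsub>fgroup c\<^esub>i\<in>UNIV. var i [^]\<^bsub>fgroup c\<^esub> lam i \<otimes>\<^bsub>fgroup c\<^esub> var i [^]\<^bsub>fgroup c\<^esub> mu i)"
    by (simp add: xlp_def int_pow_mult v del: carrier_fgroup mult_fgroup)
  also have "\<dots> = xlp c lam \<otimes>\<^bsub>fgroup c\<^esub> xlp c mu"
    unfolding xlp_def by (intro finprod_multf Pi_I int_pow_closed v)
  finally show ?thesis
    by simp
qed

lemma xlp_unitvec: "xlp c (unitvec i) = (var i :: ('a, 'n::finite) ps)"
proof -
  interpret comm_group "fgroup c :: ('a, 'n) ps monoid"
    by (rule comm_group_fgroup)
  have v: "(var i :: ('a, 'n) ps) \<in> carrier (fgroup c)" for i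
    by (simp del: One_nat_def)
  have "xlp c (unitvec i) = (\<Otimes>\<^bsub>fgroup c\<^esub>j\<in>UNIV. if i = j then var j else \<one>\<^bsub>fgroup c\<^esub> :: ('a, 'n) ps)"
    unfolding xlp_def by (intro finprod_cong') (use v one_closed in \<open>auto simp: unitvec_def simp del: carrier_fgroup\<close>)
  also have "\<dots> = var i"
    by (rule finprod_singleton) (auto simp: v simp del: carrier_fgroup)
  finally show ?thesis .
qed

section \<open>Endomorphisms induced by maps of the lattice\<close>

lemma additive_eqI:
  fixes h h' :: "('n::finite \<Rightarrow> int) \<Rightarrow> ('a, 'k::finite) ps"
  assumes "\<And>x y. h (x + y) = fsum c (h x) (h y)" "\<And>x y. h' (x + y) = fsum c (h' x) (h' y)"
    and "\<And>x. aug 1 (h x)" "\<And>x. aug 1 (h' x)" and "\<And>i. h (unitvec i) = h' (unitvec i)"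
  shows "h lam = h' lam"
proof -
  interpret comm_group "fgroup c :: ('a, 'k) ps monoid"
    by (rule comm_group_fgroup)
  show ?thesis
    using additive_eq_finprod[of h lam] additive_eq_finprod[of h' lam] assms by simp
qed

text \<open>One construction serves the group elements and doubling alike. Only the values of
  \<open>T\<close> on unit vectors enter; additivity is demanded where it is used.\<close>

definition lmap :: "(('n \<Rightarrow> int) \<Rightarrow> ('n \<Rightarrow> int)) \<Rightarrow> ('a, 'n::finite) ps \<Rightarrow> ('a, 'n) ps" where
  "lmap T = gsubst (\<lambda>i. xlp c (T (unitvec i)))"

lemma cont_hom_lmap: "cont_hom (lmap T)"
  unfolding lmap_def by (rule cont_hom_gsubst) (rule aug_xlp)

lemma lmap_var: "lmap T (var i) = xlp c (T (unitvec i))"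
  unfolding lmap_def by (rule gsubst_var) (rule aug_xlp)

lemma lmap_xlp:
  assumes T: "\<And>x y. T (x + y) = T x + T y"
  shows "lmap T (xlp c lam) = xlp c (T lam)"
proof (rule additive_eqI[where h = "\<lambda>x. lmap T (xlp c x)"])
  interpret cont_hom "lmap T" by (rule cont_hom_lmap)
  show "lmap T (xlp c (x + y)) = fsum c (lmap T (xlp c x)) (lmap T (xlp c y))" for x y
    unfolding xlp_add by (rule fsum; rule aug_xlp)
  show "aug 1 (lmap T (xlp c x))" for x
    by (intro aug aug_xlp)
  show "xlp c (T (x + y)) = fsum c (xlp c (T x)) (xlp c (T y))" for x y
    by (simp only: T xlp_add)
qed (simp_all add: aug_xlp xlp_unitvec lmap_var del: One_nat_def)

text \<open>The inner map sends a variable to some x_mu, which the outer map moves to x_(T mu) by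
  additivity of \<open>T\<close>; agreement on the variables is enough.\<close>

lemma lmap_comp:
  assumes "\<And>x y. T (x + y) = T x + T y"
  shows "lmap T (lmap S f) = lmap (\<lambda>x. T (S x)) f"
  by (rule cont_hom_eqI[OF cont_hom_compose[OF cont_hom_lmap cont_hom_lmap] cont_hom_lmap])
     (simp add: lmap_var lmap_xlp assms)

end

text \<open>Modulo order 2 formal addition is ordinary addition, so the linear part of x_lambda is
  additive in lambda. On unit vectors it is the variable itself, whatever the formal group
  law.\<close>

lemma xlp_linear_unique:
  fixes lam :: "'n::finite \<Rightarrow> int"
  assumes "formal_group_law c" "formal_group_law (c' :: nat \<Rightarrow> nat \<Rightarrow> 'a::comm_ring_1)"
  shows "aug 2 (xlp c lam - (xlp c' lam :: ('a, 'n) ps))"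
proof -
  \<comment> \<open>In the ordinary additive group of series, the product formula for additive maps
    gives an expression free of the formal group law.\<close>
  let ?A = "\<lparr>carrier = UNIV, mult = (+), one = 0\<rparr> :: ('a, 'n) ps monoid"
  interpret comm_group ?A
    by (rule comm_groupI) (auto simp: ac_simps intro: exI[of _ "- _"])
  define lin :: "('a, 'n) ps \<Rightarrow> ('a, 'n) ps" where "lin f = trunc 2 f" for f
  have lin_eq: "lin f = lin g \<longleftrightarrow> aug 2 (f - g)" for f g
    unfolding lin_def aug_diff_iff by (metis coeff_trunc ps_eqI)
  have lin_add: "lin (f + g) = lin f + lin g" for f g
    by (rule ps_eqI) (simp add: lin_def coeff_trunc)
  have "lin (xlp c lam) = (\<Otimes>\<^bsub>?A\<^esub>i\<in>UNIV. lin (var i) [^]\<^bsub>?A\<^esub> lam i)" if "formal_group_law c" for c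
  proof -
    interpret formal_group_law c by fact
    have "lin (xlp c (x + y)) = lin (xlp c x) + lin (xlp c y)" for x y :: "'n \<Rightarrow> int"
      using fsum_linear[OF aug_xlp aug_xlp, of x y] by (simp add: xlp_add lin_eq flip: lin_add)
    then show ?thesis
      using additive_eq_finprod[of "\<lambda>x. lin (xlp c x)" lam] by (simp add: xlp_unitvec)
  qed
  then show ?thesis
    using assms by (simp flip: lin_eq)
qed

section \<open>Dilations\<close>

text \<open>The comparison map \<psi> scales the variables exactly and so multiplies forms of degree
  d by 2 ^ d, while \<phi> has the same linear parts.\<close>

lemma cont_hom_scale:
  assumes "cont_hom \<phi>" and var: "\<And>i. aug 2 (\<phi> (var i) - 2 * var i)" and f: "aug d f"
  shows "aug (d + 1) (\<phi> f - 2 ^ d * f)"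
proof -
  define \<psi> where "\<psi> = gsubst (\<lambda>i::'b. 2 * var i :: ('a, 'b) ps)"
  have s: "aug 1 (2 * var i :: ('a, 'b) ps)" for i :: 'b
    by (intro aug_mult_left aug_var)
  interpret \<phi>: cont_hom \<phi> by fact
  interpret \<psi>: cont_hom \<psi>
    unfolding \<psi>_def by (rule cont_hom_gsubst) (rule s)
  have \<psi>_var: "\<psi> (var i) = 2 * var i" for i
    unfolding \<psi>_def by (rule gsubst_var) (rule s)
  \<comment> \<open>Since f has order at least d, this truncation is its homogeneous part of degree
    d.\<close>
  let ?f = "trunc (d + 1) f"
  have "\<psi> ?f = (\<Sum>m\<in>{m. mdeg m < d + 1}. 2 ^ d * (const (coeff f m) * mon m))"
    unfolding \<psi>.trunc
  proof (rule sum.cong)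
    fix m :: "'b \<Rightarrow> nat"
    assume "m \<in> {m. mdeg m < d + 1}"
    then consider "mdeg m < d" | "mdeg m = d" by force
    then show "const (coeff f m) * (\<Prod>i\<in>UNIV. \<psi> (var i) ^ m i) = 2 ^ d * (const (coeff f m) * mon m)"
    proof cases
      case 1
      then show ?thesis using f by (simp add: aug_iff)
    next
      case 2
      then have "(\<Prod>i\<in>UNIV. \<psi> (var i) ^ m i) = 2 ^ d * mon m"
        by (simp add: \<psi>_var power_mult_distrib prod.distrib mon_eq_prod mdeg_def flip: power_sum)
      then show ?thesis by (simp add: ac_simps)
    qed
  qed simp
  also have "\<dots> = 2 ^ d * ?f"
    by (simp add: trunc_def sum_distrib_left)
  finally have \<psi>_trunc: "\<psi> ?f = 2 ^ d * ?f" .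
  have "aug (d + 1) (\<phi> f - \<psi> f)"
    by (rule cont_hom_leading_cong) (use assms \<psi>.cont_hom_axioms \<psi>_var in auto)
  also have "aug (d + 1) (\<psi> f - \<psi> ?f)"
    by (intro \<psi>.cong aug_trunc)
  also have "aug (d + 1) (\<psi> ?f - 2 ^ d * f)"
    unfolding \<psi>_trunc by (intro aug_mult_cong aug_diff_sym[OF aug_trunc]) simp
  finally show ?thesis .
qed

text \<open>This is all that the eigenvalue argument uses of the doubling map.\<close>

locale dilation = cont_hom \<psi> for \<psi> :: "('a::comm_ring_1, 'n::finite) ps \<Rightarrow> ('a, 'n) ps" +
  assumes scale: "aug d f \<Longrightarrow> aug (d + 1) (\<psi> f - 2 ^ d * f)"
begin

text \<open>These are the operations from which eigencomponents are formed. The instances are the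
  set of all series, for the coefficients of a combination, and the set of invariants, for its other
  factors.\<close>

definition stable :: "('a, 'n) ps set \<Rightarrow> bool" where
  "stable K \<longleftrightarrow> 0 \<in> K \<and> (\<forall>f\<in>K. \<forall>g\<in>K. f + g \<in> K \<and> f - g \<in> K) \<and>
    (\<forall>f\<in>K. \<forall>n::nat. of_nat n * f \<in> K) \<and> (\<forall>f\<in>K. \<psi> f \<in> K)"

lemma stable_sum: "stable K \<Longrightarrow> (\<And>x. x \<in> A \<Longrightarrow> h x \<in> K) \<Longrightarrow> sum h A \<in> K"
  by (induction A rule: infinite_finite_induct) (auto simp: stable_def)

lemma numeral_power_mult: "\<psi> (2 ^ k * f) = 2 ^ k * \<psi> f"
  using map_of_nat_mult[of "2 ^ k" f] by simp

text \<open>Since \<psi> acts on the j-th graded piece by 2^j, the quotient by the (d+1)-st step of the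
filtration splits, up to an integer factor, into eigenspaces of \<psi>.\<close>

lemma eigen_decomposition:
  assumes "e \<le> d + 1"
  shows "\<exists>C>0. \<forall>K f. stable K \<longrightarrow> f \<in> K \<longrightarrow> aug e f \<longrightarrow>
    (\<exists>h. (\<forall>j. h j \<in> K \<and> aug j (h j) \<and> aug (d + 1) (\<psi> (h j) - 2 ^ j * h j)) \<and>
      aug (d + 1) (of_nat C * f - (\<Sum>j=e..d. h j)))"
  using assms
\<comment> \<open>Downward induction: at e = d + 1 the series vanishes to the given precision and
  the sum is empty.\<close>
proof (induction e rule: inc_induct)
  case base
  have "\<exists>h. (\<forall>j. h j \<in> K \<and> aug j (h j) \<and> aug (d + 1) (\<psi> (h j) - 2 ^ j * h j)) \<and>
      aug (d + 1) (of_nat 1 * f - (\<Sum>j=d+1..d. h j))" if "stable K" "aug (d + 1) f" for K f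
    using that by (intro exI[of _ "\<lambda>_. 0"]) (simp add: stable_def)
  then show ?case
    by (intro exI[of _ 1]) simp
next
  case (step e)
  then obtain C where "C > 0" and C: "\<And>K f. stable K \<Longrightarrow> f \<in> K \<Longrightarrow> aug (Suc e) f \<Longrightarrow>
    (\<exists>h. (\<forall>j. h j \<in> K \<and> aug j (h j) \<and> aug (d + 1) (\<psi> (h j) - 2 ^ j * h j)) \<and>
      aug (d + 1) (of_nat C * f - (\<Sum>j=Suc e..d. h j)))"
    by blast
  \<comment> \<open>Differences of eigenvalues. Their product M is a common multiple, and
    multiplication by \<open>M div w j\<close> stands in for division by \<open>w j\<close>.\<close>
  define w where "w = (\<lambda>j. 2 ^ j - 2 ^ e :: nat)"
  define M where "M = (\<Prod>j=Suc e..d. w j)"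
  define Mj where "Mj = (\<lambda>j. M div w j)"
  have w: "w j > 0" if "j \<in> {Suc e..d}" for j
    using that by (simp add: w_def)
  have w_ps: "of_nat (w j) = (2 ^ j - 2 ^ e :: ('a, 'n) ps)" if "j \<in> {Suc e..d}" for j
    using that by (simp add: w_def of_nat_diff)
  have "M > 0"
    unfolding M_def by (intro prod_pos) (use w in auto)
  have Mj: "Mj j * w j = M" if "j \<in> {Suc e..d}" for j
    unfolding Mj_def M_def using that by (intro dvd_div_mult_self dvd_prodI) auto
  show ?case
  proof (intro exI[of _ "M * C"] conjI allI impI)
    show "M * C > 0" using \<open>M > 0\<close> \<open>C > 0\<close> by simp
  next
    fix K f
    assume K: "stable K" and f: "f \<in> K" "aug e f"
    \<comment> \<open>Subtracting 2 ^ e times f removes the component of weight e, which raises the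
      order and makes the induction hypothesis applicable.\<close>
    have "\<psi> f - of_nat (2 ^ e) * f \<in> K"
      using K f unfolding stable_def by blast
    then have g: "\<psi> f - 2 ^ e * f \<in> K"
      by simp
    obtain h where h: "\<And>j. h j \<in> K" "\<And>j. aug j (h j)" "\<And>j. aug (d + 1) (\<psi> (h j) - 2 ^ j * h j)"
      and sum_h: "aug (d + 1) (of_nat C * (\<psi> f - 2 ^ e * f) - (\<Sum>j=Suc e..d. h j))"
      using C[OF K g] scale[OF f(2)] by auto
    \<comment> \<open>Heuristically, \<open>h j\<close> is C * w j times the component of f of
      weight j, so \<open>Mj j\<close> times it is M * C times that component. What remains has
      weight e.\<close>
    define h0 where "h0 = of_nat (M * C) * f - (\<Sum>j=Suc e..d. of_nat (Mj j) * h j)"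
    have h0_K: "h0 \<in> K"
    proof -
      have "(\<Sum>j=Suc e..d. of_nat (Mj j) * h j) \<in> K" "of_nat (M * C) * f \<in> K"
        using K f(1) h(1) by (auto intro!: stable_sum[OF K] simp: stable_def simp del: of_nat_mult)
      then show ?thesis
        using K by (auto simp: stable_def h0_def)
    qed
    have h0_aug: "aug e h0"
      unfolding h0_def
      by (intro aug_diff aug_sum aug_mult_left f aug_mono[OF h(2)]) auto
    have "\<psi> h0 - 2 ^ e * h0 = of_nat M * (of_nat C * (\<psi> f - 2 ^ e * f))
        - (\<Sum>j=Suc e..d. of_nat (Mj j) * (\<psi> (h j) - 2 ^ e * h j))"
      by (simp add: h0_def diff sum map_of_nat_mult sum_distrib_left right_diff_distrib sum_subtractf
          mult.assoc mult.left_commute)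
    also have "aug (d + 1) (\<dots> - (of_nat M * (\<Sum>j=Suc e..d. h j)
        - (\<Sum>j=Suc e..d. of_nat (Mj j) * (2 ^ j * h j - 2 ^ e * h j))))"
    proof -
      have 1: "aug (d + 1) (of_nat M * (of_nat C * (\<psi> f - 2 ^ e * f)) - of_nat M * (\<Sum>j=Suc e..d. h j))"
        by (intro aug_mult_cong sum_h) simp
      have 2: "aug (d + 1) ((\<Sum>j=Suc e..d. of_nat (Mj j) * (\<psi> (h j) - 2 ^ e * h j))
          - (\<Sum>j=Suc e..d. of_nat (Mj j) * (2 ^ j * h j - 2 ^ e * h j)))"
        by (intro aug_sum_diff aug_mult_cong) (use h(3) in simp_all)
      have "a - b - (a' - b') = (a - a') - (b - b')" for a a' b b' :: "('a, 'n) ps"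
        by simp
      then show ?thesis
        using aug_diff[OF 1 2] by (simp only:)
    qed
    also have "(\<Sum>j=Suc e..d. of_nat (Mj j) * (2 ^ j * h j - 2 ^ e * h j)) = of_nat M * (\<Sum>j=Suc e..d. h j)"
      unfolding sum_distrib_left
    proof (rule sum.cong)
      fix j assume j: "j \<in> {Suc e..d}"
      have "of_nat (Mj j) * (2 ^ j * h j - 2 ^ e * h j) = of_nat (Mj j) * of_nat (w j) * h j"
        by (simp add: w_ps[OF j] algebra_simps)
      then show "of_nat (Mj j) * (2 ^ j * h j - 2 ^ e * h j) = of_nat M * h j"
        by (simp add: Mj[OF j] flip: of_nat_mult)
    qed simp
    finally have h0_eigen: "aug (d + 1) (\<psi> h0 - 2 ^ e * h0)"
      by simp
    define h' where "h' = (\<lambda>j. if j = e then h0 else of_nat (Mj j) * h j)"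
    have "h' j \<in> K \<and> aug j (h' j) \<and> aug (d + 1) (\<psi> (h' j) - 2 ^ j * h' j)" for j
    proof (cases "j = e")
      case True
      then show ?thesis
        using h0_K h0_aug h0_eigen by (simp add: h'_def)
    next
      case False
      have "\<psi> (of_nat (Mj j) * h j) - 2 ^ j * (of_nat (Mj j) * h j) = of_nat (Mj j) * (\<psi> (h j) - 2 ^ j * h j)"
        by (simp add: map_of_nat_mult right_diff_distrib mult.left_commute)
      then have "aug (d + 1) (\<psi> (of_nat (Mj j) * h j) - 2 ^ j * (of_nat (Mj j) * h j))"
        using h(3)[of j] by (simp only: aug_mult_left)
      then show ?thesis
        using False h(1,2)[of j] K by (simp add: h'_def aug_mult_left stable_def)
    qed
    moreover have "(\<Sum>j=e..d. h' j) = of_nat (M * C) * f"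
    proof -
      have "(\<Sum>j=e..d. h' j) = h' e + (\<Sum>j=Suc e..d. h' j)"
        using step.hyps by (intro sum.atLeast_Suc_atMost) simp
      also have "(\<Sum>j=Suc e..d. h' j) = (\<Sum>j=Suc e..d. of_nat (Mj j) * h j)"
        by (intro sum.cong) (auto simp: h'_def)
      finally show ?thesis
        by (simp add: h'_def h0_def)
    qed
    ultimately show "\<exists>h. (\<forall>j. h j \<in> K \<and> aug j (h j) \<and> aug (d + 1) (\<psi> (h j) - 2 ^ j * h j)) \<and>
        aug (d + 1) (of_nat (M * C) * f - (\<Sum>j=e..d. h j))"
      by (intro exI[of _ h']) simp
  qed
qed

text \<open>Applying the product of the \<psi> - 2^t annihilates the eigenvectors u t, while it acts on the
d-th step of the filtration by an integer, modulo the next step.\<close>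

lemma eigen_separation:
  assumes "k \<le> d" "aug d x" "\<And>t. t < k \<Longrightarrow> aug (d + 1) (\<psi> (u t) - 2 ^ t * u t)"
    and "aug (d + 1) (x - (\<Sum>t<k. u t))"
  shows "aug (d + 1) (of_nat (\<Prod>t<k. 2 ^ d - 2 ^ t) * x)"
  using assms
proof (induction k arbitrary: x u)
  case (Suc k)
  \<comment> \<open>This factor kills the last eigenvector u k and acts on leading forms of degree d
    by the positive integer 2 ^ d - 2 ^ k.\<close>
  define \<theta> where "\<theta> = (\<lambda>f. \<psi> f - 2 ^ k * f)"
  have \<theta>_diff: "\<theta> (f - g) = \<theta> f - \<theta> g" for f g
    by (simp add: \<theta>_def diff algebra_simps)
  have \<theta>_sum: "\<theta> (\<Sum>t<n. u t) = (\<Sum>t<n. \<theta> (u t))" for n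
    by (simp add: \<theta>_def sum sum_subtractf sum_distrib_left)
  have \<theta>_aug: "aug n (\<theta> f)" if "aug n f" for n f
    unfolding \<theta>_def by (intro aug_diff aug aug_mult_left that)
  have \<theta>_scale: "aug (d + 1) (\<theta> x - of_nat (2 ^ d - 2 ^ k) * x)"
  proof -
    have "(2::nat) ^ k \<le> 2 ^ d"
      using Suc.prems(1) by simp
    then have "of_nat (2 ^ d - 2 ^ k) = (2 ^ d - 2 ^ k :: ('a, 'n) ps)"
      by (simp add: of_nat_diff)
    then have "\<theta> x - of_nat (2 ^ d - 2 ^ k) * x = \<psi> x - 2 ^ d * x"
      by (simp only: \<theta>_def left_diff_distrib) simp
    then show ?thesis
      using scale[OF Suc.prems(2)] by simp
  qed
  \<comment> \<open>Being a polynomial in \<psi>, \<theta> commutes with it, so the other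
    eigenvectors keep their eigenvalues.\<close>
  have eigen: "aug (d + 1) (\<psi> (\<theta> (u t)) - 2 ^ t * \<theta> (u t))" if "t < k" for t
  proof -
    have "\<psi> (\<theta> (u t)) - 2 ^ t * \<theta> (u t) = \<theta> (\<psi> (u t) - 2 ^ t * u t)"
      by (simp add: \<theta>_def diff numeral_power_mult right_diff_distrib mult.left_commute)
    then show ?thesis
      using that Suc.prems(3)[of t] \<theta>_aug by simp
  qed
  have "aug (d + 1) (\<theta> x - (\<Sum>t<Suc k. \<theta> (u t)))"
    using \<theta>_aug[OF Suc.prems(4)] by (simp only: \<theta>_diff \<theta>_sum)
  moreover have "aug (d + 1) (\<theta> (u k))"
    using Suc.prems(3)[of k] by (simp add: \<theta>_def)
  ultimately have "aug (d + 1) (\<theta> x - (\<Sum>t<Suc k. \<theta> (u t)) + \<theta> (u k))"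
    by (rule aug_add)
  then have "aug (d + 1) (\<theta> x - (\<Sum>t<k. \<theta> (u t)))"
    by simp
  then have "aug (d + 1) (of_nat (\<Prod>t<k. 2 ^ d - 2 ^ t) * \<theta> x)"
    using Suc.prems(1,2) eigen \<theta>_aug by (intro Suc.IH[of "\<theta> x" "\<lambda>t. \<theta> (u t)"]) auto
  moreover have "aug (d + 1) (of_nat (\<Prod>t<k. 2 ^ d - 2 ^ t) * \<theta> x
      - of_nat (\<Prod>t<k. 2 ^ d - 2 ^ t) * (of_nat (2 ^ d - 2 ^ k) * x))"
    by (intro aug_mult_cong \<theta>_scale) simp
  ultimately have "aug (d + 1) (of_nat (\<Prod>t<k. 2 ^ d - 2 ^ t) * (of_nat (2 ^ d - 2 ^ k) * x))"
    using aug_cong by blast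
  moreover have "of_nat (\<Prod>t<Suc k. 2 ^ d - 2 ^ t) * x
      = of_nat (\<Prod>t<k. 2 ^ d - 2 ^ t) * (of_nat (2 ^ d - 2 ^ k) * x)"
    by (simp only: prod.lessThan_Suc of_nat_mult mult.assoc)
  ultimately show ?case
    by (simp only:)
qed simp

text \<open>The product is sorted by total weight t = i + j, and pairs with i + j > d fall into the
  (d+1)-st step. The second index starts at 1 because it belongs to factors without constant
  term.\<close>

lemma sum_product_truncated:
  assumes "\<And>i. aug i (a i)" "\<And>j. aug j (b j)"
  shows "aug (d + 1) ((\<Sum>i=0..d. a i) * (\<Sum>j=1..d. b j) - (\<Sum>t\<le>d. \<Sum>j=1..t. a (t - j) * b j))"
proof -
  let ?I = "{0..d} \<times> {1..d}" and ?L = "{(i, j). i + j \<le> d \<and> 1 \<le> j}"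
  have L: "?L \<subseteq> ?I" by auto
  have "(\<Sum>i=0..d. a i) * (\<Sum>j=1..d. b j) = (\<Sum>(i, j)\<in>?I. a i * b j)"
    by (simp add: sum_product sum.cartesian_product)
  also have "\<dots> = (\<Sum>(i, j)\<in>?I - ?L. a i * b j) + (\<Sum>(i, j)\<in>?L. a i * b j)"
    by (rule sum.subset_diff[OF L]) simp
  also have "(\<Sum>(i, j)\<in>?L. a i * b j) = (\<Sum>(t, j)\<in>Sigma {..d} (\<lambda>t. {1..t}). a (t - j) * b j)"
    by (rule sum.reindex_bij_witness[where i = "\<lambda>(t, j). (t - j, j)" and j = "\<lambda>(i, j). (i + j, j)"]) auto
  also have "\<dots> = (\<Sum>t\<le>d. \<Sum>j=1..t. a (t - j) * b j)"
    by (rule sum.Sigma[symmetric]) auto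
  finally have "(\<Sum>i=0..d. a i) * (\<Sum>j=1..d. b j) - (\<Sum>t\<le>d. \<Sum>j=1..t. a (t - j) * b j)
      = (\<Sum>(i, j)\<in>?I - ?L. a i * b j)"
    by simp
  also have "aug (d + 1) \<dots>"
  proof (rule aug_sum)
    fix p assume "p \<in> ?I - ?L"
    then obtain i j where "p = (i, j)" "d + 1 \<le> i + j"
      by force
    then show "aug (d + 1) (case p of (i, j) \<Rightarrow> a i * b j)"
      using aug_mono[OF aug_mult[OF assms]] by simp
  qed
  finally show ?thesis .
qed

text \<open>The point is that the lower degree terms of the summands may cancel, so the leading form of the
sum is not directly expressed by the leading forms of the summands.\<close>

lemma leading_form_decomposition:
  "\<exists>N>0. \<forall>K n a s. stable K \<longrightarrow> (\<forall>l<n. s l \<in> K \<and> aug 1 (s l)) \<longrightarrow>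
    aug d (\<Sum>l<(n::nat). a l * s l) \<longrightarrow>
    (\<exists>A S. (\<forall>l j. S l j \<in> K \<and> aug j (S l j) \<and> aug (d - j) (A l j)) \<and>
      aug (d + 1) (of_nat N * (\<Sum>l<n. a l * s l) - (\<Sum>l<n. \<Sum>j=1..d. A l j * S l j)))"
proof -
  obtain C where "C > 0" and C: "\<And>K f. stable K \<Longrightarrow> f \<in> K \<Longrightarrow> aug 0 f \<Longrightarrow>
    (\<exists>h. (\<forall>j. h j \<in> K \<and> aug j (h j) \<and> aug (d + 1) (\<psi> (h j) - 2 ^ j * h j)) \<and>
      aug (d + 1) (of_nat C * f - (\<Sum>j=0..d. h j)))"
    using eigen_decomposition[of 0 d] by blast
  obtain C' where "C' > 0" and C': "\<And>K f. stable K \<Longrightarrow> f \<in> K \<Longrightarrow> aug 1 f \<Longrightarrow>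
    (\<exists>h. (\<forall>j. h j \<in> K \<and> aug j (h j) \<and> aug (d + 1) (\<psi> (h j) - 2 ^ j * h j)) \<and>
      aug (d + 1) (of_nat C' * f - (\<Sum>j=1..d. h j)))"
    using eigen_decomposition[of 1 d] by auto
  \<comment> \<open>The integer by which \<open>eigen_separation\<close> multiplies when all weights
    t < d are eliminated.\<close>
  define D :: nat where "D = (\<Prod>t<d. 2 ^ d - 2 ^ t)"
  have "D > 0"
    unfolding D_def by (intro prod_pos) auto
  show ?thesis
  proof (intro exI[of _ "D * (C * C')"] conjI allI impI)
    show "D * (C * C') > 0"
      using \<open>C > 0\<close> \<open>C' > 0\<close> \<open>D > 0\<close> by simp
  next
    fix K a s and n :: nat
    assume K: "stable K" and s: "\<forall>l<n. s l \<in> K \<and> aug 1 (s l)" and p_aug: "aug d (\<Sum>l<n. a l * s l)"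
    let ?p = "\<Sum>l<n. a l * s l"
    \<comment> \<open>The coefficients are arbitrary series, so they are decomposed with the trivial
      choice of K.\<close>
    have "stable UNIV"
      by (simp add: stable_def)
    then have "\<forall>l. \<exists>h. (\<forall>j. aug j (h j) \<and> aug (d + 1) (\<psi> (h j) - 2 ^ j * h j)) \<and>
        aug (d + 1) (of_nat C * a l - (\<Sum>j=0..d. h j))"
      using C[of UNIV] by auto
    then obtain \<alpha> where \<alpha>: "\<And>l j. aug j (\<alpha> l j)" "\<And>l j. aug (d + 1) (\<psi> (\<alpha> l j) - 2 ^ j * \<alpha> l j)"
        and sum_\<alpha>: "\<And>l. aug (d + 1) (of_nat C * a l - (\<Sum>j=0..d. \<alpha> l j))"
      by metis
    \<comment> \<open>Padding by 0 lets components be chosen for all l at once.\<close>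
    define s' where "s' = (\<lambda>l. if l < n then s l else 0)"
    have "s' l \<in> K" "aug 1 (s' l)" for l
      using s K unfolding s'_def stable_def by (cases "l < n"; simp)+
    then have "\<forall>l. \<exists>h. (\<forall>j. h j \<in> K \<and> aug j (h j) \<and> aug (d + 1) (\<psi> (h j) - 2 ^ j * h j)) \<and>
        aug (d + 1) (of_nat C' * s' l - (\<Sum>j=1..d. h j))"
      using C'[OF K] by blast
    then obtain S where S: "\<And>l j. S l j \<in> K" "\<And>l j. aug j (S l j)"
        "\<And>l j. aug (d + 1) (\<psi> (S l j) - 2 ^ j * S l j)"
        and sum_S: "\<And>l. aug (d + 1) (of_nat C' * s' l - (\<Sum>j=1..d. S l j))"
      by metis
    \<comment> \<open>The part of total weight t. As \<psi> is multiplicative, a product of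
      eigenvectors of weights t - j and j is an eigenvector of weight t.\<close>
    define u where "u = (\<lambda>t. \<Sum>l<n. \<Sum>j=1..t. \<alpha> l (t - j) * S l j)"
    have u_aug: "aug t (u t)" for t
      unfolding u_def
    proof (intro aug_sum)
      fix l j assume "j \<in> {1..t}"
      then show "aug t (\<alpha> l (t - j) * S l j)"
        using aug_mult[OF \<alpha>(1)[of "t - j" l] S(2)[of j l]] by simp
    qed
    have u_eigen: "aug (d + 1) (\<psi> (u t) - 2 ^ t * u t)" for t
      unfolding u_def sum mult sum_distrib_left
    proof (intro aug_sum_diff)
      fix l j assume "j \<in> {1..t}"
      then have "2 ^ t * (\<alpha> l (t - j) * S l j) = (2 ^ (t - j) * \<alpha> l (t - j)) * (2 ^ j * S l j)"
        by (simp add: ac_simps flip: power_add)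
      then show "aug (d + 1) (\<psi> (\<alpha> l (t - j)) * \<psi> (S l j) - 2 ^ t * (\<alpha> l (t - j) * S l j))"
        by (simp only:) (intro aug_mult_cong \<alpha>(2) S(3))
    qed
    have sum_u: "(\<Sum>t\<le>d. u t) = (\<Sum>l<n. \<Sum>t\<le>d. \<Sum>j=1..t. \<alpha> l (t - j) * S l j)"
      unfolding u_def by (rule sum.swap)
    have "of_nat (C * C') * ?p = (\<Sum>l<n. (of_nat C * a l) * (of_nat C' * s' l))"
      by (simp add: sum_distrib_left s'_def ac_simps)
    also have "aug (d + 1) (\<dots> - (\<Sum>l<n. (\<Sum>i=0..d. \<alpha> l i) * (\<Sum>j=1..d. S l j)))"
      by (intro aug_sum_diff aug_mult_cong sum_\<alpha> sum_S)
    also have "aug (d + 1) ((\<Sum>l<n. (\<Sum>i=0..d. \<alpha> l i) * (\<Sum>j=1..d. S l j)) - (\<Sum>t\<le>d. u t))"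
      unfolding sum_u by (intro aug_sum_diff sum_product_truncated \<alpha> S)
    finally have "aug (d + 1) (of_nat (C * C') * ?p - (\<Sum>t\<le>d. u t))" .
    moreover have "(\<Sum>t\<le>d. u t) = (\<Sum>t<d. u t) + u d"
      by (simp flip: lessThan_Suc_atMost)
    \<comment> \<open>Removing u d leaves a series of order d that is a sum of eigenvectors of
      weights below d. Separation kills D times this series modulo the next step, so only weight d
      contributes to the leading form.\<close>
    ultimately have "aug (d + 1) ((of_nat (C * C') * ?p - u d) - (\<Sum>t<d. u t))"
      by (simp add: algebra_simps)
    moreover have "aug d (of_nat (C * C') * ?p - u d)"
      by (intro aug_diff aug_mult_left p_aug u_aug)
    ultimately have "aug (d + 1) (of_nat D * (of_nat (C * C') * ?p - u d))"
      unfolding D_def using u_eigen by (intro eigen_separation[where u = u]) simp_all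
    moreover have "of_nat D * (of_nat (C * C') * ?p - u d)
        = of_nat (D * (C * C')) * ?p - (\<Sum>l<n. \<Sum>j=1..d. (of_nat D * \<alpha> l (d - j)) * S l j)"
      by (simp add: u_def right_diff_distrib sum_distrib_left mult.assoc)
    ultimately show "\<exists>A S. (\<forall>l j. S l j \<in> K \<and> aug j (S l j) \<and> aug (d - j) (A l j)) \<and>
        aug (d + 1) (of_nat (D * (C * C')) * ?p - (\<Sum>l<n. \<Sum>j=1..d. A l j * S l j))"
      using S(1,2) \<alpha>(1)
      by (intro exI[of _ "\<lambda>l j. of_nat D * \<alpha> l (d - j)"] exI[of _ S]) (simp add: aug_mult_left)
  qed
qed

end

section \<open>Invariants\<close>

lemma mps_monom_subst_coeff:
  "mps_monom_subst (\<lambda>i. coeff (\<sigma> i)) m = coeff (\<Prod>i\<in>UNIV. \<sigma> i ^ m i)"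
proof -
  have "foldr (\<lambda>i acc. mps_mult (mps_pow (coeff (\<sigma> i)) (m i)) acc) xs mps_one
      = coeff (\<Prod>i\<in>set xs. \<sigma> i ^ m i)" if "distinct xs" for xs
    using that
    by (induction xs) (simp_all add: one_ps_def times_ps_def mps_pow_coeff)
  then show ?thesis
    by (simp add: mps_monom_subst_def enum_distinct UNIV_enum)
qed

context formal_group_law
begin

lemma act_ps_coeff: "act_ps c act g (coeff f) = coeff (lmap (act g) f)"
  by (simp add: act_ps_def mps_subst_def xl_eq mps_monom_subst_coeff lmap_def gsubst_def)

lemma dilation_lmap: "dilation (lmap (\<lambda>x. x + x) :: ('a, 'n::finite) ps \<Rightarrow> ('a, 'n) ps)"
proof (intro dilation.intro cont_hom_lmap dilation_axioms.intro)
  fix d and f :: "('a, 'n) ps"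
  assume "aug d f"
  have "aug 2 (lmap (\<lambda>x. x + x) (var i) - 2 * var i :: ('a, 'n) ps)" for i
    unfolding lmap_var xlp_add xlp_unitvec mult_2 by (intro fsum_linear aug_var)
  then show "aug (d + 1) (lmap (\<lambda>x. x + x) f - 2 ^ d * f)"
    by (intro cont_hom_scale cont_hom_lmap \<open>aug d f\<close>)
qed

text \<open>By \<open>xlp_linear_unique\<close> the images of the variables under the two maps have
  the same linear parts.\<close>

lemma lmap_leading_cong:
  assumes "formal_group_law c'" "aug d f"
  shows "aug (d + 1) (lmap T f - formal_group_law.lmap c' T f)"
proof -
  interpret c': formal_group_law c' by fact
  show ?thesis
    by (intro cont_hom_leading_cong cont_hom_lmap c'.cont_hom_lmap assms)
       (simp only: lmap_var c'.lmap_var xlp_linear_unique formal_group_law_axioms assms)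
qed

end

locale lattice_action = formal_group_law c + group G
  for c :: "nat \<Rightarrow> nat \<Rightarrow> 'a::comm_ring_1" and G :: "('g, 'b) monoid_scheme" (structure) +
  fixes act :: "'g \<Rightarrow> ('n::enum \<Rightarrow> int) \<Rightarrow> ('n \<Rightarrow> int)"
  assumes lin: "lin_action G act" and fin: "finite (carrier G)"
begin

lemma act_add: "g \<in> carrier G \<Longrightarrow> act g (x + y) = act g x + act g y"
  and act_mult: "g \<in> carrier G \<Longrightarrow> h \<in> carrier G \<Longrightarrow> act (g \<otimes> h) = (\<lambda>x. act g (act h x))"
  using lin by (auto simp: lin_action_def plus_fun_def)

definition invs :: "('a, 'n) ps set" where
  "invs = {f. \<forall>g\<in>carrier G. lmap (act g) f = f}"

lemma invariants_eq: "coeff f \<in> invariants c G act \<longleftrightarrow> f \<in> invs"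
  by (simp add: invariants_def invs_def act_ps_coeff coeff_inject)

text \<open>Doubling commutes with each \<open>act g\<close> by additivity, hence so do the induced
  endomorphisms, and the image of an invariant is again invariant.\<close>

lemma stable_invs: "dilation.stable (lmap (\<lambda>x. x + x)) invs"
proof -
  interpret dilation "lmap (\<lambda>x. x + x) :: ('a, 'n) ps \<Rightarrow> ('a, 'n) ps"
    by (rule dilation_lmap)
  have "lmap (act g) (lmap (\<lambda>x. x + x) f) = lmap (\<lambda>x. x + x) (lmap (act g) f)"
    if "g \<in> carrier G" for g and f :: "('a, 'n) ps"
  proof -
    have "lmap (act g) (lmap (\<lambda>x. x + x) f) = lmap (\<lambda>x. act g (x + x)) f"
      using that by (intro lmap_comp) (rule act_add)
    also have "\<dots> = lmap (\<lambda>x. act g x + act g x) f"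
      using that by (simp only: act_add)
    also have "\<dots> = lmap (\<lambda>x. x + x) (lmap (act g) f)"
      by (rule lmap_comp[symmetric]) (simp only: add.assoc add.commute add.left_commute)
    finally show ?thesis .
  qed
  then show ?thesis
    unfolding stable_def invs_def
    by (simp add: cont_hom.add[OF cont_hom_lmap] cont_hom.diff[OF cont_hom_lmap]
        cont_hom.zero[OF cont_hom_lmap] cont_hom.map_of_nat_mult[OF cont_hom_lmap])
qed

lemma orbit_sum_invs: "(\<Sum>g\<in>carrier G. lmap (act g) f) \<in> invs"
  unfolding invs_def
proof (intro CollectI ballI)
  fix h assume h: "h \<in> carrier G"
  have "lmap (act h) (\<Sum>g\<in>carrier G. lmap (act g) f) = (\<Sum>g\<in>carrier G. lmap (act h) (lmap (act g) f))"
    by (rule cont_hom.sum[OF cont_hom_lmap])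
  also have "\<dots> = (\<Sum>g\<in>carrier G. lmap (act (h \<otimes> g)) f)"
  proof (rule sum.cong)
    fix g assume "g \<in> carrier G"
    then show "lmap (act h) (lmap (act g) f) = lmap (act (h \<otimes> g)) f"
      using h by (simp only: act_mult) (intro lmap_comp act_add)
  qed simp
  also have "\<dots> = (\<Sum>g\<in>carrier G. lmap (act g) f)"
    using h by (intro sum.reindex_bij_witness[where i = "\<lambda>g. inv h \<otimes> g" and j = "\<lambda>g. h \<otimes> g"])
      (auto simp: inv_solve_left simp flip: m_assoc)
  finally show "lmap (act h) (\<Sum>g\<in>carrier G. lmap (act g) f) = (\<Sum>g\<in>carrier G. lmap (act g) f)" .
qed

section \<open>The ideal generated by the invariants without constant term\<close>

lemma coeff_sum_mult: "coeff (\<Sum>x\<in>X. a x * s x) = (\<lambda>m. \<Sum>x\<in>X. mps_mult (coeff (a x)) (coeff (s x)) m)"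
  by (rule ext) (simp add: times_ps_def)

text \<open>Arbitrary finite index sets are allowed because the combination built in the end carries
  two indices.\<close>

lemma inv_idealI:
  assumes "finite X" "\<And>x. x \<in> X \<Longrightarrow> s x \<in> invs \<and> aug 1 (s x)"
  shows "coeff (\<Sum>x\<in>X. a x * s x) \<in> inv_ideal c G act"
proof -
  obtain b where b: "bij_betw b {0..<card X} X"
    using ex_bij_betw_nat_finite[OF assms(1)] by blast
  have "coeff (\<Sum>x\<in>X. a x * s x) = coeff (\<Sum>j<card X. a (b j) * s (b j))"
    using sum.reindex_bij_betw[OF b, of "\<lambda>x. a x * s x"] by (simp add: atLeast0LessThan)
  moreover have "coeff (s (b j)) \<in> invariants c G act \<and> coeff (s (b j)) (\<lambda>i. 0) = 0" if "j < card X" for j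
    using assms(2)[OF bij_betw_apply[OF b, of j]] that
    by (simp add: invariants_eq aug_iff mdeg_eq_0_iff zero_fun_def)
  ultimately show ?thesis
    unfolding inv_ideal_def mem_Collect_eq coeff_sum_mult
    by (intro exI[of _ "card X"] exI[of _ "\<lambda>j. coeff (a (b j))"] exI[of _ "\<lambda>j. coeff (s (b j))"]) auto
qed

lemma inv_idealE:
  assumes "p \<in> inv_ideal c G act"
  obtains a s n where "p = coeff (\<Sum>l<(n::nat). a l * s l)" "\<And>l. l < n \<Longrightarrow> s l \<in> invs \<and> aug 1 (s l)"
proof -
  obtain n a s where s: "\<forall>j<n. s j \<in> invariants c G act \<and> s j (\<lambda>i. 0) = 0"
      and p: "p = (\<lambda>m. \<Sum>j<(n::nat). mps_mult (a j) (s j) m)"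
    using assms unfolding inv_ideal_def by blast
  show ?thesis
  proof (rule that)
    show "p = coeff (\<Sum>l<n. Ps (a l) * Ps (s l))"
      by (simp only: p coeff_sum_mult coeff_Ps)
    show "Ps (s l) \<in> invs \<and> aug 1 (Ps (s l))" if "l < n" for l
      using s that by (simp add: aug_iff mdeg_eq_0_iff zero_fun_def flip: invariants_eq)
  qed
qed

end

text \<open>Both formal group algebras are identified with one ring of power series through the
  basis, so leading forms for F and F' can be compared coefficient by coefficient.\<close>

lemma graded_inv_multiple:
  fixes F F' :: "nat \<Rightarrow> nat \<Rightarrow> 'a::comm_ring_1" and act :: "'g \<Rightarrow> ('n::enum \<Rightarrow> int) \<Rightarrow> ('n \<Rightarrow> int)"
  assumes "lattice_action F G act" "lattice_action F' G act"
  shows "\<exists>N>0. \<forall>p\<in>inv_ideal F' G act. in_aug_pow d p \<longrightarrow>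
    (\<exists>q\<in>inv_ideal F G act. in_aug_pow d q \<and> (\<forall>m. mdeg m = d \<longrightarrow> of_nat N * p m = q m))"
proof -
  interpret F: lattice_action F G act by fact
  interpret F': lattice_action F' G act by fact
  interpret dilation "F'.lmap (\<lambda>x. x + x) :: ('a, 'n) ps \<Rightarrow> ('a, 'n) ps"
    by (rule F'.dilation_lmap)
  obtain N where "N > 0" and N: "\<And>K n a s. stable K \<Longrightarrow> (\<forall>l<n. s l \<in> K \<and> aug 1 (s l)) \<Longrightarrow>
    aug d (\<Sum>l<(n::nat). a l * s l) \<Longrightarrow>
    (\<exists>A S. (\<forall>l j. S l j \<in> K \<and> aug j (S l j) \<and> aug (d - j) (A l j)) \<and>
      aug (d + 1) (of_nat N * (\<Sum>l<n. a l * s l) - (\<Sum>l<n. \<Sum>j=1..d. A l j * S l j)))"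
    using leading_form_decomposition[of d] by blast
  let ?G = "card (carrier G)"
  show ?thesis
  proof (intro exI[of _ "?G * N"] conjI ballI impI)
    show "?G * N > 0"
      using \<open>N > 0\<close> F.fin F.one_closed by (auto simp: card_gt_0_iff)
  next
    fix p assume p: "p \<in> inv_ideal F' G act" "in_aug_pow d p"
    obtain a s n where p_eq: "p = coeff (\<Sum>l<(n::nat). a l * s l)"
      and s: "\<And>l. l < n \<Longrightarrow> s l \<in> F'.invs \<and> aug 1 (s l)"
      using p(1) by (rule F'.inv_idealE) blast
    let ?p = "\<Sum>l<n. a l * s l"
    have p_aug: "aug d ?p"
      using p(2) by (simp add: p_eq aug_def)
    obtain A S where S: "\<And>l j. S l j \<in> F'.invs" "\<And>l j. aug j (S l j)" and A: "\<And>l j. aug (d - j) (A l j)"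
      and p_S: "aug (d + 1) (of_nat N * ?p - (\<Sum>l<n. \<Sum>j=1..d. A l j * S l j))"
      using N[OF F'.stable_invs _ p_aug] s by blast
    define T where "T = (\<lambda>l j. \<Sum>g\<in>carrier G. F.lmap (act g) (S l j))"
    have T_aug: "aug j (T l j)" for l j
      unfolding T_def by (intro aug_sum cont_hom.aug[OF F.cont_hom_lmap] S)
    have T_lead: "aug (j + 1) (of_nat ?G * S l j - T l j)" for l j
    proof -
      \<comment> \<open>By F'-invariance the multiple by the group order is a sum of F'-translates,
        which is compared with the F-orbit sum term by term.\<close>
      have "F'.lmap (act g) (S l j) = S l j" if "g \<in> carrier G" for g
        using S(1)[of l j] that by (simp add: F'.invs_def)
      then have "of_nat ?G * S l j = (\<Sum>g\<in>carrier G. F'.lmap (act g) (S l j))"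
        by simp
      then show ?thesis
        unfolding T_def
        by (simp only:) (intro aug_sum_diff F'.lmap_leading_cong F.formal_group_law_axioms S)
    qed
    define q where "q = (\<Sum>l<n. \<Sum>j=1..d. A l j * T l j)"
    have "of_nat (?G * N) * ?p = of_nat ?G * (of_nat N * ?p)"
      by (simp add: mult.assoc)
    also have "aug (d + 1) (\<dots> - of_nat ?G * (\<Sum>l<n. \<Sum>j=1..d. A l j * S l j))"
      by (intro aug_mult_cong p_S) simp
    also have "of_nat ?G * (\<Sum>l<n. \<Sum>j=1..d. A l j * S l j) = (\<Sum>l<n. \<Sum>j=1..d. A l j * (of_nat ?G * S l j))"
      by (simp add: sum_distrib_left ac_simps)
    also have "aug (d + 1) (\<dots> - q)"
      unfolding q_def
    proof (intro aug_sum_diff)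
      fix l j assume j: "j \<in> {1..d}"
      \<comment> \<open>The coefficient of order d - j lifts the error of order j + 1 past degree d;
        \<open>j \<le> d\<close> makes the truncated difference exact.\<close>
      have "aug ((d - j) + (j + 1)) (A l j * (of_nat ?G * S l j - T l j))"
        by (intro aug_mult A T_lead)
      then show "aug (d + 1) (A l j * (of_nat ?G * S l j) - A l j * T l j)"
        using j by (simp add: right_diff_distrib)
    qed
    finally have pq: "aug (d + 1) (of_nat (?G * N) * ?p - q)" .
    have "aug d q"
      unfolding q_def
    proof (intro aug_sum)
      fix l j assume "j \<in> {1..d}"
      then show "aug d (A l j * T l j)"
        using aug_mult[OF A[of j l] T_aug[of j l]] by simp
    qed
    moreover have "coeff q \<in> inv_ideal F G act"
    proof -
      have "q = (\<Sum>x\<in>{..<n} \<times> {1..d}. A (fst x) (snd x) * T (fst x) (snd x))"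
        by (simp add: q_def sum.cartesian_product case_prod_unfold)
      \<comment> \<open>Since j starts at 1, the orbit sums have no constant term, as membership in
        the ideal requires.\<close>
      moreover have "T (fst x) (snd x) \<in> F.invs \<and> aug 1 (T (fst x) (snd x))"
        if "x \<in> {..<n} \<times> {1..d}" for x
        using that aug_mono[OF T_aug] unfolding T_def by (auto simp: F.orbit_sum_invs)
      ultimately show ?thesis
        by (simp add: F.inv_idealI)
    qed
    moreover have "of_nat (?G * N) * p m = coeff q m" if "mdeg m = d" for m
    proof -
      have "coeff (of_nat (?G * N) * ?p) m = coeff q m"
        using pq that by (simp only: aug_diff_iff)
      then show ?thesis
        by (simp only: p_eq of_nat_eq_const coeff_const_mult)
    qed
    ultimately show "\<exists>q\<in>inv_ideal F G act. in_aug_pow d q \<and> (\<forall>m. mdeg m = d \<longrightarrow> of_nat (?G * N) * p m = q m)"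
      by (auto simp: aug_def)
  qed
qed

theorem theorem5p2:
  fixes F F' :: "nat \<Rightarrow> nat \<Rightarrow> 'a::comm_ring_1"
    and G :: "('g, 'b) monoid_scheme"
    and act :: "'g \<Rightarrow> ('n::enum \<Rightarrow> int) \<Rightarrow> ('n \<Rightarrow> int)"
    and d :: nat
  assumes "CHAR('a) = 0"
    and "fgl F" and "fgl F'"
    and "group G" and "finite (carrier G)"
    and "lin_action G act"
    and "d \<ge> 1"
  shows "has_finite_exponent F F' G act d"
proof -
  have "lattice_action F G act" "lattice_action F' G act"
    using assms by (auto simp: lattice_action_def lattice_action_axioms_def formal_group_law_def)
  then obtain N :: nat where "N > 0" and N: "\<And>p. p \<in> inv_ideal F' G act \<Longrightarrow> in_aug_pow d p \<Longrightarrow>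
      \<exists>q\<in>inv_ideal F G act. in_aug_pow d q \<and> (\<forall>m. mdeg m = d \<longrightarrow> of_nat N * p m = q m)"
    using graded_inv_multiple[of F G act F' d] by blast
  have "(\<lambda>m. of_nat N * p m) \<in> Phi_d F F' d ` graded_inv F G act d" if p_in: "p \<in> graded_inv F' G act d" for p
  proof -
    obtain P where p: "p = (\<lambda>m. if mdeg m = d then P m else 0)"
        and P: "P \<in> inv_ideal F' G act" "in_aug_pow d P"
      using p_in unfolding graded_inv_def by blast
    obtain q where q: "q \<in> inv_ideal F G act" "in_aug_pow d q" "\<And>m. mdeg m = d \<Longrightarrow> of_nat N * P m = q m"
      using N[OF P] by blast
    have "(\<lambda>m. if mdeg m = d then q m else 0) \<in> graded_inv F G act d"
      using q(1,2) by (auto simp: graded_inv_def)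
    moreover have "(\<lambda>m. of_nat N * p m) = Phi_d F F' d (\<lambda>m. if mdeg m = d then q m else 0)"
      using q(3) by (auto simp: Phi_d_def p)
    ultimately show ?thesis
      by blast
  qed
  \<comment> \<open>In characteristic 0 every positive N is admissible as an exponent.\<close>
  then show ?thesis
    using \<open>N > 0\<close> assms(1) unfolding has_finite_exponent_def by blast
qed

end
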